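(* Let $X$ be a Banach space. Suppose that for every equivalent norm on $X$ the dual unit ball has a very smooth point, i.e. for every equivalent norm $|\cdot|$ on $X$ the dual space $(X,|\cdot|)^*$ with its dual norm has a very smooth point. Then $X$ has the Radon--Nikodým property.
   Context: A unit vector $x$ of a Banach space $Z$ is a smooth point of $Z$ if there is exactly one $z^* \in Z^*$ with $\|z^*\| = 1 = z^*(x)$. A unit vector $x \in Z$ is a very smooth point of $Z$ if, regarded as an element of $Z^{**}$ under the canonical embedding $Z \subset Z^{**}$, it is a smooth point of $Z^{**}$. *)

theory Defs
  imports "HOL-Analysis.Analysis"
begin

definition equivalent_norm :: "('z::real_normed_vector \<Rightarrow> real) \<Rightarrow> bool" where
  "equivalent_norm p \<longleftrightarrow>
     (\<forall>x. p x = 0 \<longleftrightarrow> x = 0) \<and>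
     (\<forall>c x. p (c *\<^sub>R x) = \<bar>c\<bar> * p x) \<and>
     (\<forall>x y. p (x + y) \<le> p x + p y) \<and>
     (\<exists>c>0. \<exists>C>0. \<forall>x. c * norm x \<le> p x \<and> p x \<le> C * norm x)"

text \<open>
  A renorming is carried by a function \<open>p\<close> rather than by a new type. An equivalent norm does not
  change the set of continuous functionals, so the dual of \<open>(Z, p)\<close> is the type
  \<open>'z \<Rightarrow>\<^sub>L real\<close> together with the norm \<open>dual_norm p\<close>, which is again equivalent to the norm
  of that type; hence \<open>dual_norm\<close> can be iterated to obtain the norms of the higher duals.
\<close>

definition dual_norm :: "('z::real_normed_vector \<Rightarrow> real) \<Rightarrow> ('z \<Rightarrow>\<^sub>L real) \<Rightarrow> real" where
  "dual_norm p f = (SUP x\<in>{x. p x \<le> 1}. \<bar>blinfun_apply f x\<bar>)"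

definition canonical_embedding ::
    "'z::real_normed_vector \<Rightarrow> ('z \<Rightarrow>\<^sub>L real) \<Rightarrow>\<^sub>L real" where
  "canonical_embedding z = blinfun.prod_left z"

lemma canonical_embedding_apply [simp]:
  "blinfun_apply (canonical_embedding z) f = blinfun_apply f z"
  by (simp add: canonical_embedding_def)

definition smooth_point :: "('z::real_normed_vector \<Rightarrow> real) \<Rightarrow> 'z \<Rightarrow> bool" where
  "smooth_point p z \<longleftrightarrow>
     p z = 1 \<and> (\<exists>!f :: 'z \<Rightarrow>\<^sub>L real. dual_norm p f = 1 \<and> blinfun_apply f z = 1)"

definition very_smooth_point :: "('z::real_normed_vector \<Rightarrow> real) \<Rightarrow> 'z \<Rightarrow> bool" where
  "very_smooth_point p z \<longleftrightarrow>
     p z = 1 \<and> smooth_point (dual_norm (dual_norm p)) (canonical_embedding z)"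

text \<open>
  The library's \<open>has_bochner_integral\<close> requires a second countable range space. For an arbitrary
  normed range space, Borel measurability has to be replaced by strong measurability.
\<close>

definition strongly_measurable :: "'b measure \<Rightarrow> ('b \<Rightarrow> 'a::real_normed_vector) \<Rightarrow> bool" where
  "strongly_measurable M g \<longleftrightarrow>
     (\<exists>s. (\<forall>n::nat. simple_function M (s n)) \<and> (AE w in M. (\<lambda>n. s n w) \<longlonglongrightarrow> g w))"

definition has_strong_bochner_integral ::
    "'b measure \<Rightarrow> ('b \<Rightarrow> 'a::real_normed_vector) \<Rightarrow> 'a \<Rightarrow> bool" where
  "has_strong_bochner_integral M g x \<longleftrightarrow>
     strongly_measurable M g \<and>
     (\<exists>s. (\<forall>n::nat. Bochner_Integration.simple_bochner_integrable M (s n)) \<and>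
          (\<lambda>n. \<integral>\<^sup>+ w. ennreal (norm (g w - s n w)) \<partial>M) \<longlonglongrightarrow> 0 \<and>
          (\<lambda>n. Bochner_Integration.simple_bochner_integral M (s n)) \<longlonglongrightarrow> x)"

definition vector_measure :: "'b measure \<Rightarrow> ('b set \<Rightarrow> 'a::real_normed_vector) \<Rightarrow> bool" where
  "vector_measure M m \<longleftrightarrow>
     (\<forall>A :: nat \<Rightarrow> 'b set. range A \<subseteq> sets M \<longrightarrow> disjoint_family A \<longrightarrow>
        (\<lambda>n. m (A n)) sums m (\<Union>n. A n))"

definition bounded_variation :: "'b measure \<Rightarrow> ('b set \<Rightarrow> 'a::real_normed_vector) \<Rightarrow> bool" where
  "bounded_variation M m \<longleftrightarrow>
     (\<exists>C. \<forall>P. finite P \<longrightarrow> P \<subseteq> sets M \<longrightarrow> partition_on (space M) P \<longrightarrow>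
        (\<Sum>A\<in>P. norm (m A)) \<le> C)"

text \<open>
  For countably additive \<open>m\<close> and finite \<open>M\<close>, vanishing on null sets is the same as
  \<open>m E \<longlongrightarrow> 0\<close> for \<open>measure M E \<longlongrightarrow> 0\<close>.
\<close>

definition vm_absolutely_continuous ::
    "'b measure \<Rightarrow> ('b set \<Rightarrow> 'a::real_normed_vector) \<Rightarrow> bool" where
  "vm_absolutely_continuous M m \<longleftrightarrow> (\<forall>A\<in>null_sets M. m A = 0)"

text \<open>
  The property quantifies over all finite measure spaces, of which a formula of HOL can only see
  those on one underlying type. The type is therefore a parameter, and a theorem that leaves
  \<open>'b\<close> free asserts the property for finite measure spaces on every type.
\<close>

definition radon_nikodym_property :: "'a::banach itself \<Rightarrow> 'b itself \<Rightarrow> bool" where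
  "radon_nikodym_property X \<Omega> \<longleftrightarrow>
     (\<forall>(M :: 'b measure) (m :: 'b set \<Rightarrow> 'a).
        finite_measure M \<longrightarrow> vector_measure M m \<longrightarrow> bounded_variation M m \<longrightarrow>
        vm_absolutely_continuous M m \<longrightarrow>
        (\<exists>g :: 'b \<Rightarrow> 'a. \<forall>E\<in>sets M.
           has_strong_bochner_integral M (\<lambda>w. indicator E w *\<^sub>R g w) (m E)))"

end

theory Submission
  imports Defs
begin

text \<open>
  Suppose that a vector measure \<open>m\<close> of bounded variation, absolutely continuous with respect to a finite
  measure \<open>M\<close>, has no density. The proof builds from \<open>m\<close> an equivalent norm whose dual has no very
  smooth point. Two properties of bounded symmetric convex sets \<open>K\<close> are played off against each other.

  Very smooth points give weakly strongly exposed points. Renorm the space so that the unit ball is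
  the closure of \<open>K\<close> plus the old unit ball. Smoothness of the norm of the third dual at the image of \<open>f\<close> says that
  this norm has a linear directional derivative there, by the Hahn-Banach theorem. This forces all
  elements of the bidual ball whose value at \<open>f\<close> is close to \<open>1\<close> to be weakly close to each other.
  Consequently the slices of \<open>K\<close> by \<open>f\<close> shrink weakly to one point \<open>k\<close> of the bidual. The weak topology
  in question is that of the bidual, not the weak-star topology, so \<open>k\<close> belongs to the norm
  closure of \<open>K\<close> (\<open>exists_weakly_strongly_exposed_point\<close>).

  Measures without density give sets without such points. If every set of positive measure contained pieces of
  positive measure on which the averages of \<open>m\<close> are nearly constant, simple functions would approximate \<open>m\<close> in
  variation and converge to a density (\<open>density_if_approximable\<close>). So there are \<open>r > 0\<close> and a set \<open>E\<close>, on
  which \<open>m\<close> may be taken Lipschitz with respect to \<open>M\<close>, such that the averages over subsets of any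
  non-null part of \<open>E\<close> leave every ball of radius \<open>r\<close>. Given a point \<open>y\<close>, a Hahn decomposition
  then cuts every part of \<open>E\<close> into pieces whose averages lie in half-spaces at distance at least \<open>r\<close> from \<open>y\<close>
  (\<open>escaping_piece\<close>), and this is inherited by all smaller pieces. Doing so successively for finite nets
  of the averages met so far gives a tree of averages in which every vertex is a convex combination of its
  children, while each point of the closed convex hull of the vertices and their negatives has a weak
  neighbourhood that contains such points of bounded level only. As every slice of this hull contains some of
  arbitrarily high level, its slices never shrink weakly to one of its points (\<open>exists_set_with_escaping_slices\<close>).
\<close>

section \<open>Sublinear functionals and norming functionals\<close>

definition sublinear :: "('v::real_vector \<Rightarrow> real) \<Rightarrow> bool" where
  "sublinear q \<longleftrightarrow> (\<forall>x y. q (x + y) \<le> q x + q y) \<and> (\<forall>c x. 0 \<le> c \<longrightarrow> q (c *\<^sub>R x) = c * q x)"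

lemma sublinearI:
  assumes "\<And>x y. q (x + y) \<le> q x + q y" "\<And>c x. 0 < c \<Longrightarrow> q (c *\<^sub>R x) \<le> c * q x" "q 0 = 0"
  shows "sublinear q"
proof -
  have "q (c *\<^sub>R x) = c * q x" if "0 < c" for c x
  proof -
    have "q x = q ((1/c) *\<^sub>R (c *\<^sub>R x))" using that by simp
    also have "\<dots> \<le> (1/c) * q (c *\<^sub>R x)" using that by (intro assms(2)) simp
    finally have "c * q x \<le> q (c *\<^sub>R x)" using that by (simp add: field_simps)
    then show ?thesis using assms(2)[OF that, of x] by linarith
  qed
  then have "q (c *\<^sub>R x) = c * q x" if "0 \<le> c" for c x
    using that assms(3) by (cases "c = 0") auto
  then show ?thesis using assms(1) unfolding sublinear_def by blast
qed

lemma sublinear_add: "sublinear q \<Longrightarrow> q (x + y) \<le> q x + q y"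
  and sublinear_scaleR: "sublinear q \<Longrightarrow> 0 \<le> c \<Longrightarrow> q (c *\<^sub>R x) = c * q x"
  by (auto simp: sublinear_def)

lemma sublinear_zero: "sublinear q \<Longrightarrow> q 0 = 0"
  using sublinear_scaleR[of q 0 0] by simp

lemma sublinear_minus: "sublinear q \<Longrightarrow> - q (- x) \<le> q x"
  using sublinear_add[of q x "- x"] by (simp add: sublinear_zero)

text \<open>
  With \<open>t = 1 / s\<close> the infimum below is that of the difference quotients
  \<open>(q (z + t x) - q z) / t\<close>, so it is the one-sided directional derivative of \<open>q\<close> at \<open>z\<close> in
  direction \<open>x\<close>. In this form it makes sense for every sublinear \<open>q\<close> without a discussion of
  monotone quotients.
\<close>
definition directional_derivative :: "('v::real_vector \<Rightarrow> real) \<Rightarrow> 'v \<Rightarrow> 'v \<Rightarrow> real" where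
  "directional_derivative q z x = (INF s\<in>{0..}. q (x + s *\<^sub>R z) - s * q z)"

context
  fixes q :: "'v::real_vector \<Rightarrow> real"
  assumes q: "sublinear q"
begin

lemma directional_derivative_lower: "0 \<le> s \<Longrightarrow> - q (- x) \<le> q (x + s *\<^sub>R z) - s * q z"
  using sublinear_add[OF q, of "x + s *\<^sub>R z" "- x"] sublinear_scaleR[OF q, of s z] by simp

lemma directional_derivative_bdd: "bdd_below ((\<lambda>s. q (x + s *\<^sub>R z) - s * q z) ` {0..})"
  using directional_derivative_lower by (intro bdd_belowI2[where m = "- q (- x)"]) simp

lemma directional_derivative_le: "0 \<le> s \<Longrightarrow> directional_derivative q z x \<le> q (x + s *\<^sub>R z) - s * q z"
  unfolding directional_derivative_def by (rule cINF_lower[OF directional_derivative_bdd]) simp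

lemma directional_derivative_ge:
  "(\<And>s. 0 \<le> s \<Longrightarrow> c \<le> q (x + s *\<^sub>R z) - s * q z) \<Longrightarrow> c \<le> directional_derivative q z x"
  unfolding directional_derivative_def by (rule cINF_greatest) auto

lemma directional_derivative_approx:
  assumes "0 < e"
  shows "\<exists>s\<ge>0. q (x + s *\<^sub>R z) - s * q z < directional_derivative q z x + e"
proof (rule ccontr)
  assume "\<not> ?thesis"
  then have "directional_derivative q z x + e \<le> directional_derivative q z x"
    by (intro directional_derivative_ge) force
  with assms show False by simp
qed

lemma directional_derivative_le_self: "directional_derivative q z x \<le> q x"
  using directional_derivative_le[of 0 z x] by simp

lemma directional_derivative_minus: "directional_derivative q z (- z) \<le> - q z"
  using directional_derivative_le[of 1 z "- z"] sublinear_zero[OF q] by simp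

lemma sublinear_directional_derivative: "sublinear (directional_derivative q z)"
proof (rule sublinearI)
  fix x y
  show "directional_derivative q z (x + y) \<le> directional_derivative q z x + directional_derivative q z y"
  proof (rule field_le_epsilon)
    fix e :: real assume "0 < e"
    then have "0 < e / 2" by simp
    then obtain s t where s: "0 \<le> s" "q (x + s *\<^sub>R z) - s * q z < directional_derivative q z x + e / 2"
      and t: "0 \<le> t" "q (y + t *\<^sub>R z) - t * q z < directional_derivative q z y + e / 2"
      using directional_derivative_approx by meson
    have "directional_derivative q z (x + y) \<le> q ((x + y) + (s + t) *\<^sub>R z) - (s + t) * q z"
      using s t by (intro directional_derivative_le) simp
    moreover have "q ((x + y) + (s + t) *\<^sub>R z) \<le> q (x + s *\<^sub>R z) + q (y + t *\<^sub>R z)"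
      using sublinear_add[OF q, of "x + s *\<^sub>R z" "y + t *\<^sub>R z"] by (simp add: algebra_simps)
    ultimately show "directional_derivative q z (x + y) \<le> directional_derivative q z x + directional_derivative q z y + e"
      using s t by (simp add: algebra_simps)
  qed
next
  fix c :: real and x assume c: "0 < c"
  have "directional_derivative q z (c *\<^sub>R x) / c \<le> directional_derivative q z x"
  proof (rule directional_derivative_ge)
    fix s :: real assume s: "0 \<le> s"
    have "directional_derivative q z (c *\<^sub>R x) \<le> q (c *\<^sub>R x + (c * s) *\<^sub>R z) - (c * s) * q z"
      using s c by (intro directional_derivative_le) simp
    also have "c *\<^sub>R x + (c * s) *\<^sub>R z = c *\<^sub>R (x + s *\<^sub>R z)" by (simp add: algebra_simps)
    also have "q \<dots> = c * q (x + s *\<^sub>R z)" using c q by (simp add: sublinear_scaleR)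
    finally show "directional_derivative q z (c *\<^sub>R x) / c \<le> q (x + s *\<^sub>R z) - s * q z"
      using c by (simp add: field_simps)
  qed
  then show "directional_derivative q z (c *\<^sub>R x) \<le> c * directional_derivative q z x"
    using c by (simp add: field_simps)
next
  have "0 \<le> directional_derivative q z 0"
    using directional_derivative_lower[of _ 0 z] sublinear_zero[OF q] by (intro directional_derivative_ge) simp
  then show "directional_derivative q z 0 = 0"
    using directional_derivative_le_self[of z 0] sublinear_zero[OF q] by simp
qed

end

text \<open>
  Minimality forces \<open>p\<close> to coincide with its directional derivative at every \<open>z\<close>. In direction \<open>- z\<close>
  this gives oddness, and bounding the infimum by its term for \<open>s = 1\<close> gives superadditivity.
\<close>
lemma minimal_sublinear_is_linear:
  assumes p: "sublinear p" and min: "\<And>r. sublinear r \<Longrightarrow> (\<And>x. r x \<le> p x) \<Longrightarrow> r = p"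
  shows "p (x + y) = p x + p y" "p (c *\<^sub>R x) = c * p x"
proof -
  have eq: "directional_derivative p z = p" for z
    by (rule min) (auto intro: sublinear_directional_derivative directional_derivative_le_self p)
  have neg: "p (- z) = - p z" for z
    using directional_derivative_minus[OF p, of z] sublinear_minus[OF p, of z] eq[of z] by simp
  have "p x + p y \<le> p (x + y)" for x y
    using directional_derivative_le[OF p, of 1 y x] eq by simp
  then show "p (x + y) = p x + p y" using sublinear_add[OF p, of x y] by (simp add: antisym)
  show "p (c *\<^sub>R x) = c * p x"
  proof (cases "0 \<le> c")
    case False
    then have "p (- ((- c) *\<^sub>R x)) = - ((- c) * p x)"
      unfolding neg using sublinear_scaleR[OF p, of "- c" x] by simp
    then show ?thesis by simp
  qed (simp add: sublinear_scaleR p)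
qed

text \<open>
  The infimum is finite because a sublinear \<open>r \<le> q\<close> satisfies \<open>- q (- x) \<le> r x\<close>. It is subadditive because
  members of the chain that are almost minimal at \<open>x\<close> and at \<open>y\<close> can be replaced by the smaller of the two.
\<close>
lemma sublinear_chain_inf:
  fixes C :: "('v::real_vector \<Rightarrow> real) set"
  assumes sub: "\<And>r. r \<in> C \<Longrightarrow> sublinear r" and le: "\<And>r x. r \<in> C \<Longrightarrow> r x \<le> q x" and ne: "C \<noteq> {}"
    and chain: "\<And>r s. r \<in> C \<Longrightarrow> s \<in> C \<Longrightarrow> (\<forall>x. r x \<le> s x) \<or> (\<forall>x. s x \<le> r x)"
  shows "sublinear (\<lambda>x. INF r\<in>C. r x)" "\<And>r x. r \<in> C \<Longrightarrow> (INF r\<in>C. r x) \<le> r x"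
proof -
  have bdd: "bdd_below ((\<lambda>r. r x) ` C)" for x
  proof (rule bdd_belowI2)
    fix r assume r: "r \<in> C"
    show "- q (- x) \<le> r x"
      using sublinear_minus[OF sub[OF r], of x] le[OF r, of "- x"] by simp
  qed
  show low: "\<And>r x. r \<in> C \<Longrightarrow> (INF r\<in>C. r x) \<le> r x" by (rule cINF_lower[OF bdd])
  have appr: "\<exists>r\<in>C. r x < (INF r\<in>C. r x) + e" if "0 < e" for x e
    using cINF_less_iff[OF ne bdd, of x "(INF r\<in>C. r x) + e"] that by simp
  show "sublinear (\<lambda>x. INF r\<in>C. r x)"
  proof (rule sublinearI)
    fix x y
    show "(INF r\<in>C. r (x + y)) \<le> (INF r\<in>C. r x) + (INF r\<in>C. r y)"
    proof (rule field_le_epsilon)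
      fix e :: real assume "0 < e"
      then have "0 < e / 2" by simp
      then obtain r s where rs: "r \<in> C" "s \<in> C" "r x < (INF r\<in>C. r x) + e / 2" "s y < (INF r\<in>C. r y) + e / 2"
        using appr by meson
      then obtain t where t: "t \<in> C" "t x \<le> r x" "t y \<le> s y" using chain by (metis order_refl)
      have "(INF r\<in>C. r (x + y)) \<le> t x + t y"
        using low[OF t(1), of "x + y"] sublinear_add[OF sub[OF t(1)], of x y] by simp
      then show "(INF r\<in>C. r (x + y)) \<le> (INF r\<in>C. r x) + (INF r\<in>C. r y) + e"
        using t rs by simp
    qed
  next
    fix c :: real and x assume c: "0 < c"
    have "(INF r\<in>C. r (c *\<^sub>R x)) / c \<le> (INF r\<in>C. r x)"
    proof (rule cINF_greatest[OF ne])
      fix r assume r: "r \<in> C"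
      show "(INF r\<in>C. r (c *\<^sub>R x)) / c \<le> r x"
        using low[OF r, of "c *\<^sub>R x"] sublinear_scaleR[OF sub[OF r], of c x] c by (simp add: field_simps)
    qed
    then show "(INF r\<in>C. r (c *\<^sub>R x)) \<le> c * (INF r\<in>C. r x)" using c by (simp add: field_simps)
  next
    have "(\<lambda>r. r 0) ` C = {0::real}" using ne sub sublinear_zero by fastforce
    then show "(INF r\<in>C. r 0) = (0::real)" by simp
  qed
qed

lemma exists_minimal_sublinear:
  assumes q: "sublinear q"
  shows "\<exists>p. sublinear p \<and> (\<forall>x. p x \<le> q x) \<and> (\<forall>r. sublinear r \<longrightarrow> (\<forall>x. r x \<le> p x) \<longrightarrow> r = p)"
proof -
  define S where "S = {p. sublinear p \<and> (\<forall>x. p x \<le> q x)}"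
  define P where "P = (\<lambda>p r :: 'a \<Rightarrow> real. \<forall>x. r x \<le> p x)"
  have "\<exists>m\<in>S. \<forall>a\<in>S. P m a \<longrightarrow> a = m"
  proof (rule predicate_Zorn)
    show "partial_order_on S (relation_of P S)"
    proof (rule partial_order_on_relation_ofI)
      show "P a c" if "P a b" "P b c" for a b c
        using that unfolding P_def by (meson order_trans)
      show "a = b" if "P a b" "P b a" for a b
        using that unfolding P_def by (intro ext antisym) auto
    qed (simp add: P_def)
  next
    fix C assume C: "C \<in> Chains (relation_of P S)"
    then have CS: "C \<subseteq> S" by (auto simp: Chains_def relation_of_def)
    show "\<exists>u\<in>S. \<forall>a\<in>C. P a u"
    proof (cases "C = {}")
      case True
      then show ?thesis using q by (auto simp: S_def)
    next
      case False
      have sub: "\<And>r. r \<in> C \<Longrightarrow> sublinear r" and le: "\<And>r x. r \<in> C \<Longrightarrow> r x \<le> q x"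
        using CS unfolding S_def by blast+
      have ch: "\<And>r s. r \<in> C \<Longrightarrow> s \<in> C \<Longrightarrow> (\<forall>x. r x \<le> s x) \<or> (\<forall>x. s x \<le> r x)"
        using C unfolding Chains_def relation_of_def P_def by blast
      define u where "u = (\<lambda>x. INF r\<in>C. r x)"
      have u: "sublinear u" "\<And>r x. r \<in> C \<Longrightarrow> u x \<le> r x"
        unfolding u_def using sublinear_chain_inf[of C q] sub le False ch by blast+
      obtain r where r: "r \<in> C" using False by blast
      have "u x \<le> q x" for x
        using u(2)[OF r, of x] le[OF r, of x] by (rule order_trans)
      then have "u \<in> S" using u(1) unfolding S_def by blast
      then show ?thesis using u(2) unfolding P_def by blast
    qed
  qed
  then obtain m where m: "m \<in> S" "\<And>a. a \<in> S \<Longrightarrow> P m a \<Longrightarrow> a = m" by blast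
  have "r = m" if r: "sublinear r" "\<forall>x. r x \<le> m x" for r
  proof (rule m(2))
    have "r x \<le> q x" for x
      using order_trans[of "r x" "m x" "q x"] r(2) m(1) unfolding S_def by simp
    then show "r \<in> S" using r(1) unfolding S_def by blast
    show "P m r" using r(2) unfolding P_def by blast
  qed
  then show ?thesis using m(1) unfolding S_def by blast
qed

text \<open>
  A minimal sublinear functional below \<open>q\<close> is linear. Minimising below the directional derivative of
  \<open>q\<close> at \<open>z\<close> instead fixes the value at \<open>z\<close>, since in direction \<open>- z\<close> that derivative is at most \<open>- q z\<close>.
\<close>
theorem hahn_banach_sublinear:
  fixes q :: "'v::real_normed_vector \<Rightarrow> real"
  assumes q: "sublinear q" and bd: "\<And>x. q x \<le> C * norm x"
  shows "\<exists>F :: 'v \<Rightarrow>\<^sub>L real. (\<forall>x. F x \<le> q x) \<and> F z = q z"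
proof -
  obtain p where p: "sublinear p" "\<And>x. p x \<le> directional_derivative q z x"
    and min: "\<And>r. sublinear r \<Longrightarrow> (\<And>x. r x \<le> p x) \<Longrightarrow> r = p"
    using exists_minimal_sublinear[OF sublinear_directional_derivative[OF q, of z]] by metis
  note lin = minimal_sublinear_is_linear[OF p(1) min]
  have le: "p x \<le> q x" for x using p(2)[of x] directional_derivative_le_self[OF q, of z x] by simp
  have neg: "p (- x) = - p x" for x using lin(2)[of "-1" x] by simp
  have "\<bar>p x\<bar> \<le> norm x * C" for x
    using le[of x] le[of "- x"] bd[of x] bd[of "- x"] neg[of x] by (simp add: mult.commute)
  then have bl: "bounded_linear p"
    by (intro bounded_linear_intro[where K = C]) (auto simp: lin)
  have "p z \<ge> q z" using p(2)[of "- z"] directional_derivative_minus[OF q, of z] neg[of z] by simp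
  with le[of z] have "p z = q z" by simp
  then show ?thesis
    by (intro exI[of _ "Blinfun p"]) (simp add: bounded_linear_Blinfun_apply[OF bl] le)
qed

section \<open>Equivalent norms and their duals\<close>

lemma equivalent_norm_sublinear: "equivalent_norm p \<Longrightarrow> sublinear p"
  by (auto simp: equivalent_norm_def sublinear_def)

lemma equivalent_norm_zero: "equivalent_norm p \<Longrightarrow> p 0 = 0"
  by (simp add: equivalent_norm_def)

lemma equivalent_norm_minus: "equivalent_norm p \<Longrightarrow> p (- x) = p x"
  unfolding equivalent_norm_def by (metis abs_minus_cancel abs_one mult_1 scaleR_minus1_left)

lemma equivalent_norm_nonneg: "equivalent_norm p \<Longrightarrow> 0 \<le> p x"
  unfolding equivalent_norm_def by (meson dual_order.trans less_imp_le mult_nonneg_nonneg norm_ge_zero)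

lemma equivalent_norm_scaleR: "equivalent_norm p \<Longrightarrow> p (c *\<^sub>R x) = \<bar>c\<bar> * p x"
  by (simp add: equivalent_norm_def)

lemma equivalent_normE:
  assumes "equivalent_norm p"
  obtains c C where "0 < c" "0 < C" "\<And>x. c * norm x \<le> p x" "\<And>x. p x \<le> C * norm x"
  using assms unfolding equivalent_norm_def by blast

lemma dual_norm_bdd:
  assumes "equivalent_norm p"
  shows "bdd_above ((\<lambda>x. \<bar>blinfun_apply (f :: 'a::real_normed_vector \<Rightarrow>\<^sub>L real) x\<bar>) ` {x. p x \<le> 1})"
proof -
  obtain c C where c: "0 < c" "\<And>x. c * norm x \<le> p x" using equivalent_normE[OF assms] by metis
  have "\<bar>blinfun_apply f x\<bar> \<le> norm f * (1 / c)" if "p x \<le> 1" for x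
  proof -
    have "norm x \<le> 1 / c" using c(1) c(2)[of x] that by (simp add: field_simps)
    then have "norm f * norm x \<le> norm f * (1 / c)" by (intro mult_left_mono) auto
    then show ?thesis using norm_blinfun[of f x] by simp
  qed
  then show ?thesis by (intro bdd_aboveI2) auto
qed

lemma dual_norm_upper:
  assumes "equivalent_norm p" "p x \<le> 1"
  shows "\<bar>blinfun_apply f x\<bar> \<le> dual_norm p f"
  unfolding dual_norm_def by (rule cSUP_upper[OF _ dual_norm_bdd[OF assms(1)]]) (use assms in simp)

lemma dual_norm_least:
  assumes "equivalent_norm p" "\<And>x. p x \<le> 1 \<Longrightarrow> \<bar>blinfun_apply f x\<bar> \<le> C"
  shows "dual_norm p f \<le> C"
proof -
  have "p 0 \<le> 1" using equivalent_norm_zero[OF assms(1)] by simp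
  then show ?thesis unfolding dual_norm_def by (intro cSUP_least) (use assms(2) in auto)
qed

lemma dual_norm_bound:
  assumes p: "equivalent_norm p"
  shows "\<bar>blinfun_apply f x\<bar> \<le> dual_norm p f * p x"
proof (cases "x = 0")
  case True
  then show ?thesis using equivalent_norm_zero[OF p] by simp
next
  case False
  then have pos: "0 < p x" using p equivalent_norm_nonneg[OF p, of x] by (auto simp: equivalent_norm_def less_le)
  have "p ((1 / p x) *\<^sub>R x) = 1"
    using pos by (simp only: equivalent_norm_scaleR[OF p]) simp
  from dual_norm_upper[OF p eq_refl[OF this], of f] show ?thesis
    using pos by (simp add: blinfun.scaleR_right field_simps abs_mult)
qed

lemma equivalent_norm_dual_norm:
  assumes p: "equivalent_norm p"
  shows "equivalent_norm (dual_norm p)"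
proof -
  obtain c C where c: "0 < c" "\<And>x. c * norm x \<le> p x" and C: "0 < C" "\<And>x. p x \<le> C * norm x"
    using equivalent_normE[OF p] by metis
  have upper: "dual_norm p f \<le> (1 / c) * norm f" for f
  proof (rule dual_norm_least[OF p])
    fix x assume "p x \<le> 1"
    then have "norm x \<le> 1 / c" using c(1) c(2)[of x] by (simp add: field_simps)
    then have "norm f * norm x \<le> norm f * (1 / c)" by (intro mult_left_mono) auto
    then show "\<bar>blinfun_apply f x\<bar> \<le> (1 / c) * norm f" using norm_blinfun[of f x] by simp
  qed
  have nonneg: "0 \<le> dual_norm p f" for f
    using dual_norm_upper[OF p, of 0 f] equivalent_norm_zero[OF p] by simp
  have lower: "(1 / C) * norm f \<le> dual_norm p f" for f
  proof -
    have "norm f \<le> dual_norm p f * C"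
    proof (rule norm_blinfun_bound)
      show "0 \<le> dual_norm p f * C" using nonneg C by simp
      fix x
      have "dual_norm p f * p x \<le> dual_norm p f * (C * norm x)"
        using C(2)[of x] nonneg by (intro mult_left_mono) auto
      then show "norm (blinfun_apply f x) \<le> dual_norm p f * C * norm x"
        using dual_norm_bound[OF p, of f x] by simp
    qed
    then show ?thesis using C by (simp add: field_simps)
  qed
  have le: "dual_norm p (a *\<^sub>R f) \<le> \<bar>a\<bar> * dual_norm p f" for a f
    by (rule dual_norm_least[OF p])
       (auto simp: blinfun.scaleR_left abs_mult intro!: mult_left_mono dual_norm_upper[OF p])
  have zero: "dual_norm p 0 = 0" using le[of 0 0] nonneg[of 0] by simp
  have scale: "dual_norm p (a *\<^sub>R f) = \<bar>a\<bar> * dual_norm p f" for a f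
  proof (cases "a = 0")
    case False
    then show ?thesis using le[of a f] le[of "1 / a" "a *\<^sub>R f"] by (simp add: field_simps)
  qed (simp add: zero)
  have add: "dual_norm p (f + g) \<le> dual_norm p f + dual_norm p g" for f g
  proof (rule dual_norm_least[OF p])
    fix x assume x: "p x \<le> 1"
    show "\<bar>blinfun_apply (f + g) x\<bar> \<le> dual_norm p f + dual_norm p g"
      using dual_norm_upper[OF p x, of f] dual_norm_upper[OF p x, of g] by (simp add: blinfun.add_left)
  qed
  have "f = 0" if "dual_norm p f = 0" for f
    using lower[of f] that C(1) by (simp add: field_simps)
  then have "dual_norm p f = 0 \<longleftrightarrow> f = 0" for f using zero by auto
  then show ?thesis
    unfolding equivalent_norm_def using scale add lower upper c(1) C(1)
    by (metis divide_pos_pos zero_less_one)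
qed

lemma exists_norming_functional:
  fixes z :: "'v::real_normed_vector"
  shows "\<exists>F :: 'v \<Rightarrow>\<^sub>L real. norm F \<le> 1 \<and> blinfun_apply F z = norm z"
proof -
  have "sublinear (norm :: 'v \<Rightarrow> real)" by (rule sublinearI) (auto intro: norm_triangle_ineq)
  then obtain F :: "'v \<Rightarrow>\<^sub>L real" where F: "\<And>x. F x \<le> norm x" "F z = norm z"
    using hahn_banach_sublinear[of norm 1 z] by auto
  have "norm F \<le> 1"
    by (rule norm_blinfun_bound)
       (use F(1) F(1)[of "- _"] in \<open>auto simp: abs_le_iff blinfun.minus_right\<close>)
  with F show ?thesis by blast
qed

lemma norm_canonical_embedding: "norm (canonical_embedding z) = norm z"
proof (rule antisym)
  show "norm (canonical_embedding z) \<le> norm z"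
    by (rule norm_blinfun_bound) (simp_all add: norm_blinfun mult.commute[of "norm z"] flip: real_norm_def)
  obtain F :: "'a \<Rightarrow>\<^sub>L real" where F: "norm F \<le> 1" "F z = norm z"
    using exists_norming_functional[of z] by blast
  then have "norm (canonical_embedding z) * norm F \<le> norm (canonical_embedding z)"
    by (simp add: mult_left_le)
  then show "norm z \<le> norm (canonical_embedding z)"
    using norm_blinfun[of "canonical_embedding z" F] F(2) by simp
qed

lemma linear_canonical_embedding: "linear canonical_embedding"
  by (rule linearI; rule blinfun_eqI) (simp_all add: blinfun.bilinear_simps)

section \<open>Smoothness and weak convergence of slices\<close>

text \<open>
  For each \<open>\<Phi>\<close> some functional below the directional derivative of \<open>q\<close> at \<open>z\<close> attains that
  derivative at \<open>\<Phi>\<close>. It supports the ball at \<open>z\<close>, so it is the unique support functional \<open>F\<close>;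
  hence \<open>F \<Phi>\<close> is the derivative.
\<close>
lemma smooth_point_derivative:
  assumes q: "equivalent_norm q" and sm: "smooth_point q z"
  shows "\<exists>F. \<forall>\<Phi>. directional_derivative q z \<Phi> = blinfun_apply F \<Phi>"
proof -
  note sub = equivalent_norm_sublinear[OF q]
  obtain F where F: "\<And>G. dual_norm q G = 1 \<Longrightarrow> blinfun_apply G z = 1 \<Longrightarrow> G = F" and z: "q z = 1"
    using sm unfolding smooth_point_def by blast
  obtain c C where C: "\<And>x. q x \<le> C * norm x" using equivalent_normE[OF q] by metis
  have "directional_derivative q z \<Phi> = F \<Phi>" for \<Phi>
  proof -
    have "directional_derivative q z x \<le> C * norm x" for x
      using directional_derivative_le_self[OF sub, of z x] C[of x] by simp
    then obtain G :: "'a \<Rightarrow>\<^sub>L real" where G: "\<And>x. G x \<le> directional_derivative q z x"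
      and G\<Phi>: "G \<Phi> = directional_derivative q z \<Phi>"
      using hahn_banach_sublinear[OF sublinear_directional_derivative[OF sub]] by blast
    have Gq: "G x \<le> q x" for x
      using G[of x] directional_derivative_le_self[OF sub, of z x] by simp
    have "\<bar>G x\<bar> \<le> q x" for x
      using Gq[of x] Gq[of "- x"] by (simp add: blinfun.minus_right equivalent_norm_minus[OF q])
    then have "dual_norm q G \<le> 1" by (intro dual_norm_least[OF q]) (meson order_trans)
    moreover have Gz: "G z = 1"
      using Gq[of z] G[of "- z"] directional_derivative_minus[OF sub, of z] z
      by (simp add: blinfun.minus_right)
    moreover have "1 \<le> dual_norm q G" using dual_norm_upper[OF q, of z G] Gz z by simp
    ultimately have "G = F" using F by simp
    then show ?thesis using G\<Phi> by simp
  qed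
  then show ?thesis by blast
qed

text \<open>
  Let \<open>q\<close> be the norm of the bidual and \<open>z\<close> the image of \<open>f\<close> there. An element \<open>u\<close> of the dual ball
  bounds \<open>q (\<Phi> + s *\<^sub>R z)\<close> below by \<open>\<Phi> u + s * u f\<close>. If \<open>u f\<close> is close to \<open>1\<close>, the derivative of
  \<open>q\<close> at \<open>z\<close> thus controls \<open>\<Phi> u\<close> from above, and from below through \<open>- \<Phi>\<close>. Being linear, it has
  only one possible value, namely the one at any \<open>u0\<close> that supports the ball at \<open>f\<close>.
\<close>
lemma very_smooth_point_slices_converge:
  assumes p: "equivalent_norm (p :: 'v::real_normed_vector \<Rightarrow> real)"
    and vs: "very_smooth_point p f"
    and u0: "dual_norm p u0 \<le> 1" "blinfun_apply u0 f = 1" and e: "0 < (e :: real)"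
  shows "\<exists>\<delta>>0. \<forall>u. dual_norm p u \<le> 1 \<longrightarrow> 1 - \<delta> < blinfun_apply u f \<longrightarrow>
           \<bar>blinfun_apply \<Phi> u - blinfun_apply \<Phi> u0\<bar> < e"
proof -
  define q where "q = dual_norm (dual_norm p)"
  define z where "z = canonical_embedding f"
  have ep: "equivalent_norm (dual_norm p)" by (rule equivalent_norm_dual_norm[OF p])
  have eq: "equivalent_norm q" unfolding q_def by (rule equivalent_norm_dual_norm[OF ep])
  note sub = equivalent_norm_sublinear[OF eq]
  have sm: "smooth_point q z" using vs unfolding very_smooth_point_def q_def z_def by simp
  then have z: "q z = 1" by (simp add: smooth_point_def)
  obtain F where F: "\<And>\<Psi>. directional_derivative q z \<Psi> = blinfun_apply F \<Psi>"
    using smooth_point_derivative[OF eq sm] by blast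
  have upper: "\<exists>\<delta>>0. \<forall>u. dual_norm p u \<le> 1 \<longrightarrow> 1 - \<delta> < u f \<longrightarrow> \<Psi> u < F \<Psi> + d" if d: "0 < d"
    for \<Psi> :: "('v \<Rightarrow>\<^sub>L real) \<Rightarrow>\<^sub>L real" and d
  proof -
    have "0 < d / 2" using d by simp
    then obtain s where s: "0 \<le> s" "q (\<Psi> + s *\<^sub>R z) - s < F \<Psi> + d / 2"
      using directional_derivative_approx[OF sub, of "d / 2" \<Psi> z] F z by auto
    \<comment> \<open>The width of the slice is chosen so that the defect \<open>s * (1 - u f)\<close> is at most \<open>d / 2\<close>.\<close>
    have "\<Psi> u < F \<Psi> + d" if u: "dual_norm p u \<le> 1" "1 - d / (2 * (s + 1)) < u f" for u
    proof -
      have "(\<Psi> + s *\<^sub>R z) u \<le> q (\<Psi> + s *\<^sub>R z)"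
        unfolding q_def using dual_norm_upper[OF ep u(1), of "\<Psi> + s *\<^sub>R z"] by simp
      then have "\<Psi> u + s * u f \<le> q (\<Psi> + s *\<^sub>R z)"
        by (simp add: blinfun.add_left blinfun.scaleR_left z_def)
      moreover have "s * (1 - u f) \<le> s * (d / (2 * (s + 1)))"
        using u(2) s(1) by (intro mult_left_mono) auto
      moreover have "s * (d / (2 * (s + 1))) \<le> d / 2"
        using s(1) d by (simp add: field_simps)
      moreover have "s * (1 - u f) = s - s * u f" by (simp add: algebra_simps)
      ultimately show ?thesis using s(2) by linarith
    qed
    moreover have "0 < d / (2 * (s + 1))" using s d by simp
    ultimately show ?thesis by blast
  qed
  have F_u0: "F \<Psi> = \<Psi> u0" for \<Psi> :: "('v \<Rightarrow>\<^sub>L real) \<Rightarrow>\<^sub>L real"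
  proof -
    have "\<Psi> u0 \<le> F \<Psi>" for \<Psi> :: "('v \<Rightarrow>\<^sub>L real) \<Rightarrow>\<^sub>L real"
    proof (rule field_le_epsilon)
      fix d :: real assume "0 < d"
      from upper[OF this, of \<Psi>] obtain \<delta> where "0 < \<delta>"
        "\<And>u. dual_norm p u \<le> 1 \<Longrightarrow> 1 - \<delta> < u f \<Longrightarrow> \<Psi> u < F \<Psi> + d" by blast
      then show "\<Psi> u0 \<le> F \<Psi> + d" using u0 by (simp add: less_imp_le)
    qed
    from this[of \<Psi>] this[of "- \<Psi>"] show ?thesis
      by (simp add: blinfun.minus_left blinfun.minus_right)
  qed
  obtain \<delta>1 where 1: "0 < \<delta>1" "\<And>u. dual_norm p u \<le> 1 \<Longrightarrow> 1 - \<delta>1 < u f \<Longrightarrow> \<Phi> u < \<Phi> u0 + e"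
    using upper[OF e, of \<Phi>] F_u0 by auto
  obtain \<delta>2 where 2: "0 < \<delta>2" "\<And>u. dual_norm p u \<le> 1 \<Longrightarrow> 1 - \<delta>2 < u f \<Longrightarrow> (- \<Phi>) u < (- \<Phi>) u0 + e"
    using upper[OF e, of "- \<Phi>"] F_u0 by auto
  show ?thesis
  proof (intro exI[of _ "min \<delta>1 \<delta>2"] conjI allI impI)
    fix u assume u: "dual_norm p u \<le> 1" "1 - min \<delta>1 \<delta>2 < u f"
    then have "1 - \<delta>1 < u f" "1 - \<delta>2 < u f" by auto
    with 1(2)[OF u(1)] 2(2)[OF u(1)] show "\<bar>\<Phi> u - \<Phi> u0\<bar> < e"
      by (simp add: blinfun.minus_left abs_less_iff)
  qed (use 1 2 in auto)
qed

section \<open>Renorming by a symmetric convex set\<close>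

text \<open>The Minkowski functional of the sum of \<open>K\<close> and the ball of radius \<open>\<eta>\<close>.\<close>
definition thickened_gauge :: "'v::real_normed_vector set \<Rightarrow> real \<Rightarrow> 'v \<Rightarrow> real" where
  "thickened_gauge K \<eta> x = Inf {t. 0 < t \<and> (\<exists>a\<in>K. norm (x - t *\<^sub>R a) \<le> t * \<eta>)}"

locale symmetric_convex =
  fixes K :: "'v::real_normed_vector set"
  assumes convex: "convex K" and nonempty: "K \<noteq> {}" and symmetric: "a \<in> K \<Longrightarrow> - a \<in> K"
begin

lemma zero_in: "0 \<in> K"
proof -
  obtain a where a: "a \<in> K" using nonempty by blast
  have "(1/2) *\<^sub>R a + (1/2) *\<^sub>R (- a) \<in> K"
    by (rule convexD[OF convex]) (use a symmetric in auto)
  then show ?thesis by simp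
qed

lemma scale_in: "a \<in> K \<Longrightarrow> 0 \<le> t \<Longrightarrow> t \<le> 1 \<Longrightarrow> t *\<^sub>R a \<in> K"
  using convexD[OF convex, of a 0 t "1 - t"] zero_in by simp

context
  fixes \<eta> :: real
  assumes \<eta>: "0 < \<eta>"
begin

abbreviation (input) "scales x \<equiv> {t. 0 < t \<and> (\<exists>a\<in>K. norm (x - t *\<^sub>R a) \<le> t * \<eta>)}"

lemma scales_bdd: "bdd_below (scales x)"
  by (rule bdd_belowI[of _ 0]) auto

lemma gauge_le: "0 < t \<Longrightarrow> a \<in> K \<Longrightarrow> norm (x - t *\<^sub>R a) \<le> t * \<eta> \<Longrightarrow> thickened_gauge K \<eta> x \<le> t"
  unfolding thickened_gauge_def by (rule cInf_lower[OF _ scales_bdd]) auto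

lemma scales_nonempty: "scales x \<noteq> {}"
proof -
  have "norm x / \<eta> + 1 \<in> scales x"
  proof (intro CollectI conjI bexI[of _ 0])
    show "norm (x - (norm x / \<eta> + 1) *\<^sub>R 0) \<le> (norm x / \<eta> + 1) * \<eta>"
      using \<eta> by (simp add: field_simps)
  qed (use \<eta> zero_in in \<open>auto intro: add_nonneg_pos\<close>)
  then show ?thesis by blast
qed

lemma gauge_ge:
  assumes "\<And>t a. 0 < t \<Longrightarrow> a \<in> K \<Longrightarrow> norm (x - t *\<^sub>R a) \<le> t * \<eta> \<Longrightarrow> c \<le> t"
  shows "c \<le> thickened_gauge K \<eta> x"
  unfolding thickened_gauge_def by (rule cInf_greatest[OF scales_nonempty]) (use assms in auto)

lemma gauge_approx:
  assumes "0 < e"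
  obtains t a where "0 < t" "t < thickened_gauge K \<eta> x + e" "a \<in> K" "norm (x - t *\<^sub>R a) \<le> t * \<eta>"
proof -
  have "\<exists>t\<in>scales x. t < thickened_gauge K \<eta> x + e"
    using cInf_lessD[OF scales_nonempty[of x], of "thickened_gauge K \<eta> x + e"] assms
    unfolding thickened_gauge_def by auto
  then show ?thesis using that by blast
qed

lemma gauge_nonneg: "0 \<le> thickened_gauge K \<eta> x"
  by (rule gauge_ge) simp

lemma gauge_le_norm: "thickened_gauge K \<eta> x \<le> norm x / \<eta>"
proof (rule field_le_epsilon)
  fix e :: real assume e: "0 < e"
  show "thickened_gauge K \<eta> x \<le> norm x / \<eta> + e"
  proof (rule gauge_le[OF _ zero_in])
    show "norm (x - (norm x / \<eta> + e) *\<^sub>R 0) \<le> (norm x / \<eta> + e) * \<eta>"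
      using \<eta> e by (simp add: field_simps)
  qed (use \<eta> e in \<open>auto intro: add_nonneg_pos\<close>)
qed

lemma gauge_add_le_one:
  assumes "a \<in> K" "norm b \<le> \<eta>"
  shows "thickened_gauge K \<eta> (a + b) \<le> 1"
  by (rule gauge_le[of 1 a]) (use assms in auto)

lemma sublinear_gauge: "sublinear (thickened_gauge K \<eta>)"
proof (rule sublinearI)
  fix x y
  show "thickened_gauge K \<eta> (x + y) \<le> thickened_gauge K \<eta> x + thickened_gauge K \<eta> y"
  proof (rule field_le_epsilon)
    fix e :: real assume "0 < e"
    then have e: "0 < e / 2" by simp
    obtain t a where t: "0 < t" "t < thickened_gauge K \<eta> x + e / 2" "a \<in> K" "norm (x - t *\<^sub>R a) \<le> t * \<eta>"
      using gauge_approx[OF e] by blast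
    obtain s b where s: "0 < s" "s < thickened_gauge K \<eta> y + e / 2" "b \<in> K" "norm (y - s *\<^sub>R b) \<le> s * \<eta>"
      using gauge_approx[OF e] by blast
    define d where "d = (t / (t + s)) *\<^sub>R a + (s / (t + s)) *\<^sub>R b"
    have "t / (t + s) + s / (t + s) = 1" using s t by (simp flip: add_divide_distrib)
    then have "d \<in> K" unfolding d_def by (intro convexD[OF convex]) (use s t in auto)
    moreover have "(t + s) *\<^sub>R d = t *\<^sub>R a + s *\<^sub>R b"
      using s(1) t(1) by (simp add: d_def scaleR_add_right)
    then have "x + y - (t + s) *\<^sub>R d = (x - t *\<^sub>R a) + (y - s *\<^sub>R b)" by simp
    then have "norm (x + y - (t + s) *\<^sub>R d) \<le> (t + s) * \<eta>"
      using norm_triangle_ineq[of "x - t *\<^sub>R a" "y - s *\<^sub>R b"] s t by (simp add: algebra_simps)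
    ultimately have "thickened_gauge K \<eta> (x + y) \<le> t + s"
      using s(1) t(1) by (intro gauge_le) auto
    then show "thickened_gauge K \<eta> (x + y) \<le> thickened_gauge K \<eta> x + thickened_gauge K \<eta> y + e"
      using s t by simp
  qed
next
  fix c :: real and x assume c: "0 < c"
  have "thickened_gauge K \<eta> (c *\<^sub>R x) / c \<le> thickened_gauge K \<eta> x"
  proof (rule gauge_ge)
    fix t a assume t: "0 < t" "a \<in> K" "norm (x - t *\<^sub>R a) \<le> t * \<eta>"
    have "c *\<^sub>R x - (c * t) *\<^sub>R a = c *\<^sub>R (x - t *\<^sub>R a)" by (simp add: algebra_simps)
    then have "norm (c *\<^sub>R x - (c * t) *\<^sub>R a) \<le> (c * t) * \<eta>" using t(3) c by simp
    then have "thickened_gauge K \<eta> (c *\<^sub>R x) \<le> c * t" using t c by (intro gauge_le) auto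
    then show "thickened_gauge K \<eta> (c *\<^sub>R x) / c \<le> t" using c by (simp add: field_simps)
  qed
  then show "thickened_gauge K \<eta> (c *\<^sub>R x) \<le> c * thickened_gauge K \<eta> x" using c by (simp add: field_simps)
next
  show "thickened_gauge K \<eta> 0 = 0" using gauge_le_norm[of 0] gauge_nonneg[of 0] by simp
qed

lemma gauge_minus: "thickened_gauge K \<eta> (- x) = thickened_gauge K \<eta> x"
proof -
  have "thickened_gauge K \<eta> (- x) \<le> thickened_gauge K \<eta> x" for x
  proof (rule gauge_ge)
    fix t a assume t: "0 < t" "a \<in> K" "norm (x - t *\<^sub>R a) \<le> t * \<eta>"
    have "- x - t *\<^sub>R (- a) = - (x - t *\<^sub>R a)" by simp
    then have "norm (- x - t *\<^sub>R (- a)) \<le> t * \<eta>" using t(3) by (simp only: norm_minus_cancel)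
    then show "thickened_gauge K \<eta> (- x) \<le> t" by (rule gauge_le[OF t(1) symmetric[OF t(2)]])
  qed
  from this[of x] this[of "- x"] show ?thesis by simp
qed

lemma equivalent_norm_gauge:
  assumes L: "\<And>a. a \<in> K \<Longrightarrow> norm a \<le> L"
  shows "equivalent_norm (thickened_gauge K \<eta>)"
proof -
  have "0 \<le> L" using L[OF zero_in] by simp
  then have pos: "0 < L + \<eta>" using \<eta> by simp
  have lower: "(1 / (L + \<eta>)) * norm x \<le> thickened_gauge K \<eta> x" for x
  proof (rule gauge_ge)
    fix t a assume t: "0 < t" "a \<in> K" "norm (x - t *\<^sub>R a) \<le> t * \<eta>"
    have "norm x \<le> norm (x - t *\<^sub>R a) + norm (t *\<^sub>R a)" by (metis diff_add_cancel norm_triangle_ineq)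
    also have "\<dots> \<le> t * \<eta> + t * L" using t L[of a] by (intro add_mono) auto
    finally show "(1 / (L + \<eta>)) * norm x \<le> t" using pos by (simp add: field_simps)
  qed
  have zero: "thickened_gauge K \<eta> 0 = 0" by (rule sublinear_zero[OF sublinear_gauge])
  have "x = 0" if "thickened_gauge K \<eta> x = 0" for x
    using lower[of x] that pos by (simp add: field_simps)
  then have 1: "thickened_gauge K \<eta> x = 0 \<longleftrightarrow> x = 0" for x using zero by auto
  have 2: "thickened_gauge K \<eta> (c *\<^sub>R x) = \<bar>c\<bar> * thickened_gauge K \<eta> x" for c x
  proof (cases "0 \<le> c")
    case False
    have "thickened_gauge K \<eta> (c *\<^sub>R x) = thickened_gauge K \<eta> ((- c) *\<^sub>R x)"
      using gauge_minus[of "c *\<^sub>R x"] by simp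
    then show ?thesis using False sublinear_scaleR[OF sublinear_gauge, of "- c" x] by simp
  qed (simp add: sublinear_scaleR[OF sublinear_gauge])
  have 3: "thickened_gauge K \<eta> x \<le> (1 / \<eta>) * norm x" for x using gauge_le_norm[of x] by simp
  show ?thesis
    unfolding equivalent_norm_def
    using 1 2 lower 3 sublinear_add[OF sublinear_gauge] pos \<eta> by (metis divide_pos_pos zero_less_one)
qed

lemma dual_norm_gauge_ge:
  assumes en: "equivalent_norm (thickened_gauge K \<eta>)" and a: "a \<in> K"
  shows "blinfun_apply \<psi> a + \<eta> * norm \<psi> \<le> dual_norm (thickened_gauge K \<eta>) \<psi>"
proof -
  let ?d = "dual_norm (thickened_gauge K \<eta>) \<psi> - \<psi> a"
  have ball: "\<psi> b \<le> ?d" if "norm b \<le> \<eta>" for b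
    using dual_norm_upper[OF en gauge_add_le_one[OF a that], of \<psi>] by (simp add: blinfun.add_right)
  have "0 \<le> ?d" using ball[of 0] \<eta> by simp
  have "norm \<psi> \<le> ?d / \<eta>"
  proof (rule norm_blinfun_bound)
    show "0 \<le> ?d / \<eta>" using \<open>0 \<le> ?d\<close> \<eta> by simp
    fix x
    show "norm (\<psi> x) \<le> ?d / \<eta> * norm x"
    proof (cases "x = 0")
      case False
      have "\<psi> ((\<eta> / norm x) *\<^sub>R x) \<le> ?d" "\<psi> ((\<eta> / norm x) *\<^sub>R (- x)) \<le> ?d"
        by (rule ball; use False \<eta> in simp)+
      then have "\<bar>\<psi> x\<bar> * (\<eta> / norm x) \<le> ?d"
        by (auto simp: blinfun.scaleR_right blinfun.minus_right abs_if mult.commute)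
      then show ?thesis using False \<eta> by (simp add: field_simps)
    qed simp
  qed
  then show ?thesis using \<eta> by (simp add: field_simps)
qed

lemma dual_norm_gauge_le:
  assumes en: "equivalent_norm (thickened_gauge K \<eta>)"
    and s: "\<And>a. a \<in> K \<Longrightarrow> blinfun_apply \<psi> a \<le> s"
  shows "dual_norm (thickened_gauge K \<eta>) \<psi> \<le> s + \<eta> * norm \<psi>"
proof -
  have s0: "0 \<le> s" using s[OF zero_in] by simp
  have le: "\<psi> x \<le> thickened_gauge K \<eta> x * (s + \<eta> * norm \<psi>)" for x
  proof (cases "s + \<eta> * norm \<psi> = 0")
    case True
    then have "\<eta> * norm \<psi> = 0" using s0 \<eta> by (smt (verit) mult_nonneg_nonneg norm_ge_zero)
    then have "\<psi> = 0" using \<eta> by simp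
    then show ?thesis using True by simp
  next
    case False
    then have pos: "0 < s + \<eta> * norm \<psi>" using s0 \<eta> by (smt (verit) mult_nonneg_nonneg norm_ge_zero)
    have "\<psi> x / (s + \<eta> * norm \<psi>) \<le> thickened_gauge K \<eta> x"
    proof (rule gauge_ge)
      fix t a assume t: "0 < t" "a \<in> K" "norm (x - t *\<^sub>R a) \<le> t * \<eta>"
      have "\<psi> x = t * \<psi> a + \<psi> (x - t *\<^sub>R a)" by (simp add: blinfun.diff_right blinfun.scaleR_right)
      also have "\<dots> \<le> t * s + norm \<psi> * (t * \<eta>)"
      proof (rule add_mono)
        show "t * \<psi> a \<le> t * s" using s[OF t(2)] t(1) by simp
        have "\<psi> (x - t *\<^sub>R a) \<le> norm \<psi> * norm (x - t *\<^sub>R a)" using norm_blinfun[of \<psi> "x - t *\<^sub>R a"] by simp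
        also have "\<dots> \<le> norm \<psi> * (t * \<eta>)" using t by (intro mult_left_mono) auto
        finally show "\<psi> (x - t *\<^sub>R a) \<le> norm \<psi> * (t * \<eta>)" .
      qed
      finally show "\<psi> x / (s + \<eta> * norm \<psi>) \<le> t" using pos by (simp add: field_simps)
    qed
    then show ?thesis using pos by (simp add: field_simps)
  qed
  show ?thesis
  proof (rule dual_norm_least[OF en])
    fix x assume x: "thickened_gauge K \<eta> x \<le> 1"
    have n: "0 \<le> s + \<eta> * norm \<psi>" using s0 \<eta> by simp
    have "thickened_gauge K \<eta> x * (s + \<eta> * norm \<psi>) \<le> s + \<eta> * norm \<psi>"
      using mult_right_mono[OF x n] by simp
    then show "\<bar>\<psi> x\<bar> \<le> s + \<eta> * norm \<psi>"
      using le[of x] le[of "- x"] by (simp add: gauge_minus blinfun.minus_right)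
  qed
qed

end

text \<open>
  If \<open>k\<close> has positive distance to \<open>K\<close>, a small thickening of \<open>K\<close> still omits \<open>k\<close>. A functional that
  is norming at \<open>k\<close> for the gauge of the thickening stays below \<open>1\<close> on the thickening, hence below a
  smaller constant on \<open>K\<close>, and is at least \<open>1\<close> at \<open>k\<close>.
\<close>
lemma in_closure_if_dominated:
  assumes dom: "\<And>(\<Phi> :: 'v \<Rightarrow>\<^sub>L real) c. (\<And>a. a \<in> K \<Longrightarrow> \<Phi> a \<le> c) \<Longrightarrow> \<Phi> k \<le> c"
  shows "k \<in> closure K"
proof (rule ccontr)
  assume "k \<notin> closure K"
  then obtain \<eta> where \<eta>: "0 < \<eta>" "\<And>a. a \<in> K \<Longrightarrow> \<eta> < norm (k - a)"
    unfolding closure_approachable dist_norm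
    by (metis dense norm_minus_commute not_less_iff_gr_or_eq order_less_trans)
  have k1: "1 \<le> thickened_gauge K \<eta> k"
  proof (rule gauge_ge[OF \<eta>(1)])
    fix t a assume t: "0 < t" "a \<in> K" "norm (k - t *\<^sub>R a) \<le> t * \<eta>"
    show "1 \<le> t"
    proof (rule ccontr)
      assume "\<not> 1 \<le> t"
      then have "t *\<^sub>R a \<in> K" "t * \<eta> \<le> \<eta>" using t \<eta> by (auto intro: scale_in)
      with t \<eta>(2)[of "t *\<^sub>R a"] show False by simp
    qed
  qed
  obtain \<psi> :: "'v \<Rightarrow>\<^sub>L real" where \<psi>: "\<And>x. \<psi> x \<le> thickened_gauge K \<eta> x" "\<psi> k = thickened_gauge K \<eta> k"
    using hahn_banach_sublinear[OF sublinear_gauge[OF \<eta>(1)], of "1 / \<eta>" k] gauge_le_norm[OF \<eta>(1)] by auto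
  have k0: "k \<noteq> 0" using \<eta>(2)[OF zero_in] \<eta>(1) by auto
  have "\<psi> a \<le> 1 - \<eta> / norm k" if a: "a \<in> K" for a
  proof -
    have "\<psi> (a + (\<eta> / norm k) *\<^sub>R k) \<le> 1"
      using \<psi>(1) gauge_add_le_one[OF \<eta>(1) a, of "(\<eta> / norm k) *\<^sub>R k"] k0 \<eta>(1)
      by (smt (verit) divide_nonneg_nonneg nonzero_eq_divide_eq norm_eq_zero norm_ge_zero norm_scaleR real_norm_def abs_of_nonneg)
    then have "\<psi> a + (\<eta> / norm k) * \<psi> k \<le> 1" by (simp add: blinfun.add_right blinfun.scaleR_right)
    moreover have "(\<eta> / norm k) * 1 \<le> (\<eta> / norm k) * \<psi> k"
      using \<psi>(2) k1 \<eta>(1) by (intro mult_left_mono) auto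
    ultimately show ?thesis by simp
  qed
  from dom[OF this] have "\<psi> k \<le> 1 - \<eta> / norm k" .
  moreover have "0 < \<eta> / norm k" using \<eta> k0 by simp
  ultimately show False using \<psi>(2) k1 by simp
qed

end

lemma closed_range_canonical_embedding:
  "closed (range (canonical_embedding :: 'a::banach \<Rightarrow> ('a \<Rightarrow>\<^sub>L real) \<Rightarrow>\<^sub>L real))"
proof -
  have "complete (range (canonical_embedding :: 'a \<Rightarrow> ('a \<Rightarrow>\<^sub>L real) \<Rightarrow>\<^sub>L real))"
    by (rule complete_isometric_image[of 1])
       (use linear_canonical_embedding in \<open>auto simp: norm_canonical_embedding subspace_UNIV complete_UNIV linear_conv_bounded_linear
          intro!: bounded_linear_intro[of _ 1] linear_add linear_scale\<close>)
  then show ?thesis by (rule complete_imp_closed)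
qed

text \<open>
  In the norm whose ball is the closure of \<open>K\<close> plus the unit ball, the dual norm of \<open>\<psi>\<close> is \<open>\<sigma> \<psi> + norm \<psi>\<close>,
  \<open>\<sigma>\<close> being the support function of \<open>K\<close>. At a very smooth \<open>f\<close> choose \<open>k\<close>, dominated by \<open>\<sigma>\<close>, and
  \<open>b\<close>, dominated by \<open>norm\<close>, both in the bidual and exact at \<open>f\<close>. For \<open>a\<close> in \<open>K\<close> that almost maximises \<open>f\<close>,
  the elements \<open>a + b\<close> approach \<open>k + b\<close> weakly in the bidual, so \<open>a\<close> approaches \<open>k\<close>. Then \<open>k\<close> lies in
  the norm closure of \<open>K\<close>, in particular in the original space.
\<close>
theorem exists_weakly_strongly_exposed_point:
  fixes K :: "'a::banach set"
  assumes hyp: "\<And>p :: 'a \<Rightarrow> real. equivalent_norm p \<Longrightarrow>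
             \<exists>f :: 'a \<Rightarrow>\<^sub>L real. very_smooth_point (dual_norm p) f"
    and K: "symmetric_convex K" and L: "\<And>a. a \<in> K \<Longrightarrow> norm a \<le> L"
  shows "\<exists>(f :: 'a \<Rightarrow>\<^sub>L real) \<sigma> k. k \<in> closure K \<and> (\<forall>\<delta>>0. \<exists>a\<in>K. \<sigma> - \<delta> < f a) \<and>
           (\<forall>(\<psi> :: 'a \<Rightarrow>\<^sub>L real) e. 0 < e \<longrightarrow> (\<exists>\<delta>>0. \<forall>a\<in>K. \<sigma> - \<delta> < f a \<longrightarrow> \<bar>\<psi> a - \<psi> k\<bar> < e))"
proof -
  interpret symmetric_convex K by (rule K)
  define p where "p = thickened_gauge K 1"
  have ep: "equivalent_norm p" unfolding p_def by (rule equivalent_norm_gauge) (use L in auto)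
  define \<sigma> where "\<sigma> = (\<lambda>\<psi> :: 'a \<Rightarrow>\<^sub>L real. SUP a\<in>K. \<psi> a)"
  have bd: "\<psi> a \<le> norm \<psi> * L" if "a \<in> K" for \<psi> :: "'a \<Rightarrow>\<^sub>L real" and a
  proof -
    have "norm \<psi> * norm a \<le> norm \<psi> * L" using L[OF that] by (intro mult_left_mono) auto
    then show ?thesis using norm_blinfun[of \<psi> a] by simp
  qed
  then have bdd: "bdd_above ((\<lambda>a. blinfun_apply \<psi> a) ` K)" for \<psi> :: "'a \<Rightarrow>\<^sub>L real"
    by (intro bdd_aboveI2) blast
  have \<sigma>_upper: "\<psi> a \<le> \<sigma> \<psi>" if "a \<in> K" for \<psi> :: "'a \<Rightarrow>\<^sub>L real" and a
    unfolding \<sigma>_def by (rule cSUP_upper[OF that bdd])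
  have \<sigma>_least: "\<sigma> \<psi> \<le> c" if "\<And>a. a \<in> K \<Longrightarrow> \<psi> a \<le> c" for \<psi> :: "'a \<Rightarrow>\<^sub>L real" and c
    unfolding \<sigma>_def by (rule cSUP_least[OF nonempty that])
  have \<sigma>_bd: "\<sigma> \<psi> \<le> L * norm \<psi>" for \<psi> :: "'a \<Rightarrow>\<^sub>L real" by (rule \<sigma>_least) (use bd in \<open>simp add: mult.commute\<close>)
  have \<sigma>_abs: "\<bar>\<psi> a\<bar> \<le> \<sigma> \<psi>" if "a \<in> K" for \<psi> :: "'a \<Rightarrow>\<^sub>L real" and a
    using \<sigma>_upper[OF that, of \<psi>] \<sigma>_upper[OF symmetric[OF that], of \<psi>] by (simp add: blinfun.minus_right)
  have dual: "dual_norm p \<psi> = \<sigma> \<psi> + norm \<psi>" for \<psi> :: "'a \<Rightarrow>\<^sub>L real"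
  proof (rule antisym)
    show "dual_norm p \<psi> \<le> \<sigma> \<psi> + norm \<psi>"
      using dual_norm_gauge_le[of 1 \<psi> "\<sigma> \<psi>"] ep \<sigma>_upper unfolding p_def by simp
    have "\<sigma> \<psi> \<le> dual_norm p \<psi> - norm \<psi>"
      by (rule \<sigma>_least) (use dual_norm_gauge_ge[of 1 _ \<psi>] ep in \<open>auto simp: p_def algebra_simps\<close>)
    then show "\<sigma> \<psi> + norm \<psi> \<le> dual_norm p \<psi>" by simp
  qed
  obtain f where f: "very_smooth_point (dual_norm p) f" using hyp[OF ep] by blast
  have ed: "equivalent_norm (dual_norm p)" by (rule equivalent_norm_dual_norm[OF ep])
  have f1: "\<sigma> f + norm f = 1" using f unfolding very_smooth_point_def by (simp add: dual)
  have "sublinear \<sigma>"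
  proof (rule sublinearI)
    show "\<sigma> (\<psi> + \<phi>) \<le> \<sigma> \<psi> + \<sigma> \<phi>" for \<psi> \<phi> :: "'a \<Rightarrow>\<^sub>L real"
      by (rule \<sigma>_least) (auto simp: blinfun.add_left intro!: add_mono \<sigma>_upper)
    show "\<sigma> (c *\<^sub>R \<psi>) \<le> c * \<sigma> \<psi>" if "0 < c" for c and \<psi> :: "'a \<Rightarrow>\<^sub>L real"
      by (rule \<sigma>_least) (use that in \<open>auto simp: blinfun.scaleR_left intro!: mult_left_mono \<sigma>_upper\<close>)
    show "\<sigma> 0 = 0" unfolding \<sigma>_def using nonempty by simp
  qed
  then obtain k' :: "('a \<Rightarrow>\<^sub>L real) \<Rightarrow>\<^sub>L real" where k': "\<And>\<psi>. k' \<psi> \<le> \<sigma> \<psi>" "k' f = \<sigma> f"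
    using hahn_banach_sublinear[of \<sigma> L f] \<sigma>_bd by blast
  obtain b :: "('a \<Rightarrow>\<^sub>L real) \<Rightarrow>\<^sub>L real" where b: "norm b \<le> 1" "b f = norm f"
    using exists_norming_functional[of f] by blast
  have b_le: "\<bar>b \<psi>\<bar> \<le> norm \<psi>" for \<psi> :: "'a \<Rightarrow>\<^sub>L real"
    using norm_blinfun[of b \<psi>] mult_right_mono[OF b(1), of "norm \<psi>"] by simp
  have \<sigma>_minus: "\<sigma> (- \<psi>) \<le> \<sigma> \<psi>" for \<psi> :: "'a \<Rightarrow>\<^sub>L real"
    by (rule \<sigma>_least) (use \<sigma>_abs in \<open>force simp: blinfun.minus_left abs_le_iff\<close>)
  have ball: "dual_norm (dual_norm p) (v + b) \<le> 1" if "\<And>\<psi>. \<bar>v \<psi>\<bar> \<le> \<sigma> \<psi>" for v :: "('a \<Rightarrow>\<^sub>L real) \<Rightarrow>\<^sub>L real"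
  proof (rule dual_norm_least[OF ed])
    fix \<psi> assume "dual_norm p \<psi> \<le> 1"
    then show "\<bar>(v + b) \<psi>\<bar> \<le> 1"
      using that[of \<psi>] b_le[of \<psi>] by (simp add: dual blinfun.add_left)
  qed
  have k'_abs: "\<bar>k' \<psi>\<bar> \<le> \<sigma> \<psi>" for \<psi> :: "'a \<Rightarrow>\<^sub>L real"
    using k'(1)[of \<psi>] k'(1)[of "- \<psi>"] \<sigma>_minus[of \<psi>] by (simp add: blinfun.minus_right)
  have slices: "\<exists>\<delta>>0. \<forall>a\<in>K. \<sigma> f - \<delta> < f a \<longrightarrow> \<bar>\<Phi> (canonical_embedding a) - \<Phi> k'\<bar> < e"
    if e: "0 < e" for \<Phi> :: "(('a \<Rightarrow>\<^sub>L real) \<Rightarrow>\<^sub>L real) \<Rightarrow>\<^sub>L real" and e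
  proof -
    have "(k' + b) f = 1" using k'(2) b(2) f1 by (simp add: blinfun.add_left)
    from very_smooth_point_slices_converge[OF ed f ball[OF k'_abs] this e, of \<Phi>]
    obtain \<delta> where \<delta>: "0 < \<delta>" "\<And>u. dual_norm (dual_norm p) u \<le> 1 \<Longrightarrow> 1 - \<delta> < u f \<Longrightarrow> \<bar>\<Phi> u - \<Phi> (k' + b)\<bar> < e"
      by blast
    have "\<bar>\<Phi> (canonical_embedding a) - \<Phi> k'\<bar> < e" if "a \<in> K" "\<sigma> f - \<delta> < f a" for a
    proof -
      have "1 - \<delta> < (canonical_embedding a + b) f"
        using that(2) f1 b(2) by (simp add: blinfun.add_left)
      moreover have "dual_norm (dual_norm p) (canonical_embedding a + b) \<le> 1"
        by (rule ball) (use \<sigma>_abs[OF that(1)] in simp)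
      ultimately show ?thesis using \<delta>(2) by (fastforce simp: blinfun.add_right)
    qed
    with \<delta>(1) show ?thesis by blast
  qed
  have appr: "\<exists>a\<in>K. \<sigma> f - \<delta> < f a" if "0 < \<delta>" for \<delta>
    using \<sigma>_least[of f "\<sigma> f - \<delta>"] that by force
  interpret J: symmetric_convex "canonical_embedding ` K"
  proof
    show "convex (canonical_embedding ` K)"
      by (rule convex_linear_image[OF linear_canonical_embedding convex])
    show "canonical_embedding ` K \<noteq> {}" using nonempty by simp
    fix a assume "a \<in> canonical_embedding ` K"
    then show "- a \<in> canonical_embedding ` K"
      using symmetric linear_neg[OF linear_canonical_embedding] by (metis (no_types, lifting) imageE imageI)
  qed
  have kcl: "k' \<in> closure (canonical_embedding ` K)"
  proof (rule J.in_closure_if_dominated)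
    fix \<Phi> :: "(('a \<Rightarrow>\<^sub>L real) \<Rightarrow>\<^sub>L real) \<Rightarrow>\<^sub>L real" and c
    assume c: "\<And>a. a \<in> canonical_embedding ` K \<Longrightarrow> \<Phi> a \<le> c"
    show "\<Phi> k' \<le> c"
    proof (rule field_le_epsilon)
      fix e :: real assume "0 < e"
      from slices[OF this, of \<Phi>] obtain \<delta> where \<delta>: "0 < \<delta>"
        "\<And>a. a \<in> K \<Longrightarrow> \<sigma> f - \<delta> < f a \<Longrightarrow> \<bar>\<Phi> (canonical_embedding a) - \<Phi> k'\<bar> < e" by blast
      obtain a where "a \<in> K" "\<sigma> f - \<delta> < f a" using appr[OF \<delta>(1)] by blast
      with \<delta>(2)[of a] c[of "canonical_embedding a"] show "\<Phi> k' \<le> c + e" by simp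
    qed
  qed
  then have "k' \<in> range canonical_embedding"
    using closure_minimal[OF _ closed_range_canonical_embedding] by blast
  then obtain k where k: "k' = canonical_embedding k" by blast
  have dist: "norm (canonical_embedding a - canonical_embedding k) = norm (a - k)" for a
    using linear_diff[OF linear_canonical_embedding, of a k] norm_canonical_embedding[of "a - k"] by simp
  have "k \<in> closure K"
    using kcl unfolding closure_approachable k by (auto simp: dist_norm dist)
  moreover have "\<exists>\<delta>>0. \<forall>a\<in>K. \<sigma> f - \<delta> < f a \<longrightarrow> \<bar>\<psi> a - \<psi> k\<bar> < e" if "0 < e" for \<psi> :: "'a \<Rightarrow>\<^sub>L real" and e
    using slices[OF that, of "canonical_embedding \<psi>"] unfolding k by simp
  ultimately show ?thesis using appr by blast
qed

section \<open>Exhaustion and vector measures\<close>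

text \<open>
  Greedy choice: each \<open>H n\<close> has at least half of the measure available. The measures of the \<open>H n\<close> tend to \<open>0\<close>, so
  a remainder of positive measure would contain a candidate that was too large to be passed over.
\<close>
lemma (in finite_measure) exhaustion:
  assumes E: "E \<in> sets M" and Q0: "Q {}"
    and Q: "\<And>G. G \<in> sets M \<Longrightarrow> G \<subseteq> E \<Longrightarrow> 0 < measure M G \<Longrightarrow>
              \<exists>H\<in>sets M. H \<subseteq> G \<and> 0 < measure M H \<and> Q H"
  shows "\<exists>H :: nat \<Rightarrow> 'a set. range H \<subseteq> sets M \<and> disjoint_family H \<and> (\<forall>n. H n \<subseteq> E \<and> Q (H n)) \<and>
           measure M (E - (\<Union>n. H n)) = 0"
proof -
  define cand where "cand = (\<lambda>G. {H \<in> sets M. H \<subseteq> G \<and> Q H})"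
  define s where "s = (\<lambda>G. SUP H\<in>cand G. measure M H)"
  have bdd: "bdd_above (measure M ` cand G)" for G
    by (rule bdd_aboveI2[of _ _ "measure M (space M)"]) (rule bounded_measure)
  have cand0: "{} \<in> cand G" for G unfolding cand_def using Q0 by simp
  have s_upper: "measure M H \<le> s G" if "H \<in> cand G" for H G
    unfolding s_def by (rule cSUP_upper[OF that bdd])
  have "\<exists>H\<in>cand G. s G / 2 \<le> measure M H" for G
  proof (cases "s G \<le> 0")
    case True
    then show ?thesis using cand0 by force
  next
    case False
    then have "s G / 2 < (SUP H\<in>cand G. measure M H)" unfolding s_def by simp
    then show ?thesis using less_cSUP_iff[OF _ bdd] cand0 by (metis empty_iff less_imp_le)
  qed
  then obtain f where f: "\<And>G. f G \<in> cand G" "\<And>G. s G / 2 \<le> measure M (f G)" by metis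
  define U where "U = rec_nat {} (\<lambda>_ U. U \<union> f (E - U))"
  define H where "H = (\<lambda>n. f (E - U n))"
  have U_simps: "U 0 = {}" "U (Suc n) = U n \<union> H n" for n unfolding U_def H_def by simp_all
  have H: "H n \<in> sets M" "H n \<subseteq> E - U n" "Q (H n)" for n
    using f(1)[of "E - U n"] unfolding H_def cand_def by auto
  have U_eq: "U n = (\<Union>i<n. H i)" for n by (induction n) (auto simp: U_simps lessThan_Suc)
  have "H i \<inter> H j = {}" if "i < j" for i j using H(2)[of j] that unfolding U_eq by blast
  then have disj: "disjoint_family H"
    unfolding disjoint_family_on_def by (metis Int_commute linorder_neqE_nat)
  have rng: "range H \<subseteq> sets M" using H by auto
  have to0: "(\<lambda>n. measure M (H n)) \<longlonglongrightarrow> 0"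
    using finite_measure_UNION[OF rng disj] by (auto dest: sums_summable intro: summable_LIMSEQ_zero)
  have "measure M (E - (\<Union>n. H n)) = 0"
  proof (rule ccontr)
    assume "measure M (E - (\<Union>n. H n)) \<noteq> 0"
    then have "0 < measure M (E - (\<Union>n. H n))" by (simp add: zero_less_measure_iff)
    moreover have "E - (\<Union>n. H n) \<in> sets M" using E rng by auto
    ultimately obtain K where K: "K \<in> sets M" "K \<subseteq> E - (\<Union>n. H n)" "0 < measure M K" "Q K"
      using Q by blast
    have "measure M K / 2 \<le> measure M (H n)" for n
    proof -
      have "K \<in> cand (E - U n)" using K unfolding cand_def U_eq by blast
      from s_upper[OF this] show ?thesis using f(2)[of "E - U n"] unfolding H_def by simp
    qed
    then have "measure M K / 2 \<le> 0" by (intro LIMSEQ_le_const[OF to0]) auto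
    with K(3) show False by simp
  qed
  then show ?thesis using rng disj H by blast
qed

locale continuous_vector_measure = finite_measure M for M :: "'b measure" +
  fixes m :: "'b set \<Rightarrow> 'a::banach"
  assumes vm: "vector_measure M m" and bv: "bounded_variation M m"
    and ac: "vm_absolutely_continuous M m"
begin

lemma m_null: "A \<in> sets M \<Longrightarrow> measure M A = 0 \<Longrightarrow> m A = 0"
  using ac unfolding vm_absolutely_continuous_def null_sets_def by (simp add: emeasure_eq_measure)

lemma m_empty [simp]: "m {} = 0"
  by (rule m_null) auto

lemma m_additive:
  "range A \<subseteq> sets M \<Longrightarrow> disjoint_family A \<Longrightarrow> (\<lambda>n. m (A n)) sums m (\<Union>n. A n)"
  using vm unfolding vector_measure_def by blast

lemma m_Un: "A \<in> sets M \<Longrightarrow> B \<in> sets M \<Longrightarrow> A \<inter> B = {} \<Longrightarrow> m (A \<union> B) = m A + m B"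
proof -
  assume AB: "A \<in> sets M" "B \<in> sets M" "A \<inter> B = {}"
  have "(\<lambda>n. m (binaryset A B n)) sums m (\<Union>n. binaryset A B n)"
    by (rule m_additive) (use AB in \<open>auto simp: range_binaryset_eq disjoint_family_on_def binaryset_def\<close>)
  moreover have "(\<lambda>n. m (binaryset A B n)) sums (m A + m B)" by (rule binaryset_sums) simp
  ultimately show ?thesis unfolding UN_binaryset_eq by (rule sums_unique2)
qed

lemma m_split: "A \<in> sets M \<Longrightarrow> B \<in> sets M \<Longrightarrow> m A = m (A \<inter> B) + m (A - B)"
  using m_Un[of "A \<inter> B" "A - B"] by (simp add: Int_Diff_Un Int_Diff_disjoint)

lemma m_UN_finite:
  assumes "finite I" "\<And>i. i \<in> I \<Longrightarrow> A i \<in> sets M" "disjoint_family_on A I"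
  shows "m (\<Union>i\<in>I. A i) = (\<Sum>i\<in>I. m (A i))"
  using assms
proof (induction I rule: finite_induct)
  case (insert i I)
  have "A i \<inter> (\<Union>j\<in>I. A j) = {}" using insert by (auto simp: disjoint_family_on_def)
  moreover have "m (\<Union>j\<in>I. A j) = (\<Sum>j\<in>I. m (A j))"
    using insert by (auto simp: disjoint_family_on_def)
  moreover have "(\<Union>j\<in>I. A j) \<in> sets M" using insert by auto
  ultimately show ?case using insert m_Un[of "A i" "\<Union>j\<in>I. A j"] by simp
qed simp

text \<open>
  Bounded variation speaks of partitions of the whole space. A disjoint family extends to one by its
  complement, and indices with equal members can be dropped because those members are empty.
\<close>
lemma variation_bound:
  obtains C where "\<And>(A :: 'i \<Rightarrow> 'b set) I. finite I \<Longrightarrow> (\<And>i. i \<in> I \<Longrightarrow> A i \<in> sets M) \<Longrightarrow>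
    disjoint_family_on A I \<Longrightarrow> (\<Sum>i\<in>I. norm (m (A i))) \<le> C"
proof -
  obtain C where C: "\<And>P. finite P \<Longrightarrow> P \<subseteq> sets M \<Longrightarrow> partition_on (space M) P \<Longrightarrow> (\<Sum>A\<in>P. norm (m A)) \<le> C"
    using bv unfolding bounded_variation_def by blast
  have "(\<Sum>i\<in>I. norm (m (A i))) \<le> C"
    if I: "finite I" "\<And>i. i \<in> I \<Longrightarrow> A i \<in> sets M" "disjoint_family_on A I" for A :: "'i \<Rightarrow> 'b set" and I
  proof -
    define J where "J = {i\<in>I. A i \<noteq> {}}"
    define R where "R = space M - (\<Union>i\<in>I. A i)"
    define P where "P = A ` J \<union> ({R} - {{}})"
    have inj: "inj_on A J"
      using I(3) unfolding inj_on_def J_def disjoint_family_on_def by (metis (mono_tags, lifting) Int_absorb mem_Collect_eq)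
    have RM: "R \<in> sets M" unfolding R_def using I by auto
    have "(\<Sum>i\<in>I. norm (m (A i))) = (\<Sum>i\<in>J. norm (m (A i)))"
      by (rule sum.mono_neutral_right) (use I in \<open>auto simp: J_def\<close>)
    also have "\<dots> = (\<Sum>B\<in>A ` J. norm (m B))" by (simp add: sum.reindex[OF inj])
    also have "\<dots> \<le> (\<Sum>B\<in>P. norm (m B))"
      by (rule sum_mono2) (use I in \<open>auto simp: P_def J_def\<close>)
    also have "\<dots> \<le> C"
    proof (rule C)
      show "finite P" unfolding P_def J_def using I by auto
      show "P \<subseteq> sets M" unfolding P_def J_def using I RM by auto
      have sp: "A i \<subseteq> space M" if "i \<in> I" for i using sets.sets_into_space[OF I(2)[OF that]] .
      show "partition_on (space M) P"
      proof (rule partition_onI)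
        have "\<Union>P = (\<Union>i\<in>I. A i) \<union> R" unfolding P_def J_def by auto
        then show "\<Union>P = space M" using sp unfolding R_def by blast
        show "disjnt p q" if "p \<in> P" "q \<in> P" "p \<noteq> q" for p q
        proof -
          have 1: "A i \<inter> A j = {}" if "i \<in> J" "j \<in> J" "A i \<noteq> A j" for i j
            using disjoint_family_onD[OF I(3), of i j] that unfolding J_def by blast
          have 2: "A i \<inter> R = {}" if "i \<in> J" for i using that unfolding R_def J_def by blast
          have "r = R \<or> (\<exists>i\<in>J. r = A i)" if "r \<in> P" for r using that unfolding P_def by blast
          from this[OF that(1)] this[OF that(2)] show ?thesis
            using 1 2 that(3) unfolding disjnt_def by (metis Int_commute)
        qed
      qed (auto simp: P_def J_def)
    qed
    finally show ?thesis .
  qed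
  then show ?thesis using that by blast
qed

lemma sums_exhausted:
  assumes H: "range H \<subseteq> sets M" "disjoint_family H" and E: "E \<in> sets M" "measure M (E - (\<Union>n. H n)) = 0"
    and G: "G \<in> sets M" "G \<subseteq> E"
  shows "(\<lambda>n. m (G \<inter> H n)) sums m G" "(\<lambda>n. measure M (G \<inter> H n)) sums measure M G"
proof -
  let ?U = "\<Union>n. G \<inter> H n"
  have U: "?U \<in> sets M" using H G by auto
  have rng: "range (\<lambda>n. G \<inter> H n) \<subseteq> sets M" and dis: "disjoint_family (\<lambda>n. G \<inter> H n)"
    using H G unfolding disjoint_family_on_def by auto
  have "measure M (G - ?U) \<le> measure M (E - (\<Union>n. H n))"
    by (rule finite_measure_mono) (use G E H in auto)
  then have 0: "measure M (G - ?U) = 0" using E(2) by (simp add: measure_le_0_iff)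
  have "m G = m ?U + m (G - ?U)"
    using m_Un[of ?U "G - ?U"] U G(1) by (simp add: Un_absorb1 UN_subset_iff)
  also have "m (G - ?U) = 0" by (rule m_null) (use 0 U G in auto)
  finally have "m G = m ?U" by simp
  then show "(\<lambda>n. m (G \<inter> H n)) sums m G" using m_additive[OF rng dis] by simp
  have "measure M G = measure M ?U"
    using finite_measure_Diff[OF G(1) U] 0 by auto
  then show "(\<lambda>n. measure M (G \<inter> H n)) sums measure M G"
    using finite_measure_UNION[OF rng dis] by simp
qed

text \<open>
  If every subset of positive measure contained a piece on which \<open>norm (m H)\<close> is at least \<open>L\<close> times the measure, such
  pieces would exhaust \<open>E\<close> and give \<open>m\<close> a variation of at least \<open>L\<close> times the measure of \<open>E\<close>.
\<close>
lemma lipschitz_piece: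
  assumes E: "E \<in> sets M" "0 < measure M E"
  shows "\<exists>G\<in>sets M. G \<subseteq> E \<and> 0 < measure M G \<and>
           (\<exists>L. \<forall>H\<in>sets M. H \<subseteq> G \<longrightarrow> norm (m H) \<le> L * measure M H)"
proof -
  obtain C where C: "\<And>(A :: nat \<Rightarrow> 'b set) I. finite I \<Longrightarrow> (\<And>i. i \<in> I \<Longrightarrow> A i \<in> sets M) \<Longrightarrow>
    disjoint_family_on A I \<Longrightarrow> (\<Sum>i\<in>I. norm (m (A i))) \<le> C" using variation_bound by metis
  \<comment> \<open>With this \<open>L\<close> the product \<open>L * measure M E\<close> exceeds the variation bound \<open>C\<close>.\<close>
  define L where "L = C / measure M E + 1"
  have "\<exists>G\<in>sets M. G \<subseteq> E \<and> 0 < measure M G \<and>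
      (\<forall>H\<in>sets M. H \<subseteq> G \<longrightarrow> 0 < measure M H \<longrightarrow> \<not> L * measure M H \<le> norm (m H))"
  proof (rule ccontr)
    assume "\<not> ?thesis"
    then have "\<exists>H\<in>sets M. H \<subseteq> G \<and> 0 < measure M H \<and> L * measure M H \<le> norm (m H)"
      if "G \<in> sets M" "G \<subseteq> E" "0 < measure M G" for G using that by blast
    from exhaustion[OF E(1) _ this] obtain H :: "nat \<Rightarrow> 'b set" where H: "range H \<subseteq> sets M" "disjoint_family H"
      "\<And>n. H n \<subseteq> E" "\<And>n. L * measure M (H n) \<le> norm (m (H n))" "measure M (E - (\<Union>n. H n)) = 0"
      by auto
    have "E \<inter> H n = H n" for n using H(3)[of n] by blast
    then have "(\<lambda>n. measure M (H n)) sums measure M E"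
      using sums_exhausted(2)[OF H(1,2) E(1) H(5) E(1)] by simp
    then have "(\<lambda>n. \<Sum>i<n. L * measure M (H i)) \<longlonglongrightarrow> L * measure M E"
      by (simp add: sums_def sum_distrib_left[symmetric] tendsto_mult_left)
    moreover have "(\<Sum>i<n. L * measure M (H i)) \<le> C" for n
      by (rule order_trans[OF sum_mono[OF H(4)] C])
         (use H in \<open>auto simp: disjoint_family_on_def\<close>)
    ultimately have "L * measure M E \<le> C" by (intro LIMSEQ_le_const2) auto
    moreover have "L * measure M E = C + measure M E" using E(2) unfolding L_def by (simp add: field_simps)
    ultimately show False using E(2) by simp
  qed
  then obtain G where G: "G \<in> sets M" "G \<subseteq> E" "0 < measure M G"
    "\<And>H. H \<in> sets M \<Longrightarrow> H \<subseteq> G \<Longrightarrow> 0 < measure M H \<Longrightarrow> \<not> L * measure M H \<le> norm (m H)" by blast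
  have "norm (m H) \<le> L * measure M H" if "H \<in> sets M" "H \<subseteq> G" for H
    using G(4)[OF that] m_null[OF that(1)] by (cases "measure M H = 0") (auto simp: zero_less_measure_iff)
  then show ?thesis using G(1,2,3) by blast
qed

section \<open>Densities\<close>

text \<open>
  For \<open>G\<close> of positive measure: the averages of \<open>m\<close> over the non-null subsets of \<open>G\<close> lie in one ball of radius \<open>e\<close>.
\<close>
definition nearly_constant :: "real \<Rightarrow> 'b set \<Rightarrow> bool" where
  "nearly_constant e G \<longleftrightarrow> (\<exists>x. \<forall>H\<in>sets M. H \<subseteq> G \<longrightarrow> norm (m H - measure M H *\<^sub>R x) \<le> e * measure M H)"

lemma simple_bochner_integrableI:
  "simple_function M f \<Longrightarrow> Bochner_Integration.simple_bochner_integrable M f"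
  by (rule simple_bochner_integrable.intros) simp_all

abbreviation integral_on :: "'b set \<Rightarrow> ('b \<Rightarrow> 'a) \<Rightarrow> 'a" where
  "integral_on A t \<equiv> Bochner_Integration.simple_bochner_integral M (\<lambda>w. indicator A w *\<^sub>R t w)"

lemma simple_function_on:
  "A \<in> sets M \<Longrightarrow> simple_function M t \<Longrightarrow> simple_function M (\<lambda>w. indicator A w *\<^sub>R (t w :: 'a))"
  by (rule simple_function_compose2[where h = "(*\<^sub>R)"]) auto

lemma integral_on_const:
  assumes A: "A \<in> sets M"
  shows "integral_on A (\<lambda>_. x) = measure M A *\<^sub>R x"
proof -
  have "integral_on A (\<lambda>_. x) =
    (\<Sum>y\<in>(indicator A :: 'b \<Rightarrow> real) ` space M. measure M {w \<in> space M. indicator A w = y} *\<^sub>R (y *\<^sub>R x))"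
    by (rule simple_bochner_integral_partition)
       (use A in \<open>auto intro!: simple_bochner_integrableI simple_function_on\<close>)
  also have "\<dots> = (\<Sum>y\<in>{0, 1::real}. measure M {w \<in> space M. indicator A w = y} *\<^sub>R (y *\<^sub>R x))"
  proof (rule sum.mono_neutral_left)
    show "\<forall>y\<in>{0, 1} - (indicator A :: 'b \<Rightarrow> real) ` space M.
        measure M {w \<in> space M. indicator A w = y} *\<^sub>R (y *\<^sub>R x) = 0"
    proof
      fix y assume y: "y \<in> {0, 1::real} - indicator A ` space M"
      then have "{w \<in> space M. indicator A w = y} = {}" by blast
      then show "measure M {w \<in> space M. indicator A w = y} *\<^sub>R (y *\<^sub>R x) = 0" by (simp only: measure_empty) simp
    qed
  qed (auto simp: indicator_def)
  also have "\<dots> = measure M {w \<in> space M. indicator A w = (1::real)} *\<^sub>R x" by simp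
  also have "{w \<in> space M. indicator A w = (1::real)} = A"
    using sets.sets_into_space[OF A] by (auto simp: indicator_def split: if_splits)
  finally show ?thesis .
qed

lemma integral_on_steps:
  assumes "A \<in> sets M" "\<And>i. i < N \<Longrightarrow> H i \<in> sets M"
  shows "simple_function M (\<lambda>w. \<Sum>i<N. indicator (H i) w *\<^sub>R (x i :: 'a))"
    and "integral_on A (\<lambda>w. \<Sum>i<(N::nat). indicator (H i) w *\<^sub>R x i) = (\<Sum>i<N. measure M (A \<inter> H i) *\<^sub>R x i)"
proof -
  have "simple_function M (\<lambda>w. \<Sum>i<N. indicator (H i) w *\<^sub>R (x i :: 'a)) \<and>
    integral_on A (\<lambda>w. \<Sum>i<(N::nat). indicator (H i) w *\<^sub>R x i) = (\<Sum>i<N. measure M (A \<inter> H i) *\<^sub>R x i)"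
    using assms(2)
  proof (induction N)
    case 0
    then show ?case using integral_on_const[OF assms(1), of 0] by simp
  next
    case (Suc N)
    let ?t = "\<lambda>w. \<Sum>i<N. indicator (H i) w *\<^sub>R x i" and ?h = "\<lambda>w. indicator (H N) w *\<^sub>R x N"
    have t: "simple_function M ?t" using Suc by simp
    have h: "simple_function M ?h" by (rule simple_function_on) (use Suc.prems in auto)
    have th: "simple_function M (\<lambda>w. ?t w + ?h w)"
      by (rule simple_function_compose2[where h = "(+)"]) (use t h in auto)
    have "integral_on A (\<lambda>w. ?t w + ?h w) = integral_on A ?t + integral_on A ?h"
      unfolding scaleR_add_right
      by (rule simple_bochner_integral_add; rule simple_bochner_integrableI; rule simple_function_on)
         (use assms(1) t h in auto)
    also have "integral_on A ?h = integral_on (A \<inter> H N) (\<lambda>_. x N)"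
      by (simp add: indicator_inter_arith)
    also have "\<dots> = measure M (A \<inter> H N) *\<^sub>R x N"
      by (rule integral_on_const) (use assms(1) Suc.prems in auto)
    finally show ?case using th Suc by simp
  qed
  then show "simple_function M (\<lambda>w. \<Sum>i<N. indicator (H i) w *\<^sub>R (x i :: 'a))"
    "integral_on A (\<lambda>w. \<Sum>i<(N::nat). indicator (H i) w *\<^sub>R x i) = (\<Sum>i<N. measure M (A \<inter> H i) *\<^sub>R x i)" by auto
qed

text \<open>
  The difference of \<open>m\<close> and the indefinite integral of \<open>t\<close> has total variation at most \<open>e\<close>. The families are
  indexed by vectors because they will be the families of level sets of simple functions.
\<close>
definition approximates :: "real \<Rightarrow> ('b \<Rightarrow> 'a) \<Rightarrow> bool" where
  "approximates e t \<longleftrightarrow> simple_function M t \<and>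
     (\<forall>(I :: 'a set) A. finite I \<longrightarrow> (\<forall>i\<in>I. A i \<in> sets M) \<longrightarrow> disjoint_family_on A I \<longrightarrow>
        (\<Sum>i\<in>I. norm (m (A i) - integral_on (A i) t)) \<le> e)"

lemma approximatesD:
  fixes I :: "'a set"
  assumes "approximates e t" "finite I" "\<And>i. i \<in> I \<Longrightarrow> A i \<in> sets M" "disjoint_family_on A I"
  shows "(\<Sum>i\<in>I. norm (m (A i) - integral_on (A i) t)) \<le> e"
  using assms unfolding approximates_def by blast

text \<open>
  On a piece \<open>H n\<close> where \<open>m\<close> is nearly \<open>x n\<close> times the measure, take the value \<open>x n\<close>. Bounded variation makes
  the \<open>norm (x n) * measure M (H n)\<close> summable, so dropping all but finitely many pieces costs little variation.
\<close>
lemma approximates_if_nearly_constant_pieces: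
  assumes e: "0 < e"
    and pieces: "\<And>d G. 0 < d \<Longrightarrow> G \<in> sets M \<Longrightarrow> 0 < measure M G \<Longrightarrow>
      \<exists>H\<in>sets M. H \<subseteq> G \<and> 0 < measure M H \<and> nearly_constant d H"
  shows "\<exists>t. approximates e t"
proof -
  define d where "d = e / (2 * (measure M (space M) + 1))"
  have d: "0 < d" unfolding d_def using e by (simp add: add_nonneg_pos)
  have dM: "d * measure M (space M) \<le> e / 2"
  proof -
    have "e * measure M (space M) / (2 * (measure M (space M) + 1)) \<le> e / 2"
      using e by (simp add: divide_le_eq add_nonneg_pos)
    then show ?thesis unfolding d_def by simp
  qed
  have empty: "nearly_constant d {}" unfolding nearly_constant_def by simp
  from exhaustion[of "space M" "nearly_constant d", OF sets.top empty] pieces[OF d] obtain H :: "nat \<Rightarrow> 'b set" where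
    H: "range H \<subseteq> sets M" "disjoint_family H" "measure M (space M - (\<Union>n. H n)) = 0"
    and "\<And>n. nearly_constant d (H n)" by blast
  then obtain x where x: "\<And>n G. G \<in> sets M \<Longrightarrow> G \<subseteq> H n \<Longrightarrow> norm (m G - measure M G *\<^sub>R x n) \<le> d * measure M G"
    unfolding nearly_constant_def by metis
  have HM: "H n \<in> sets M" for n using H(1) by auto
  note ex = sums_exhausted[OF H(1,2) sets.top H(3)]
  define c where "c = (\<lambda>n. norm (x n) + d)"
  have c0: "0 \<le> c n" for n unfolding c_def using d by simp
  have mc: "norm (m G) \<le> c n * measure M G" if "G \<in> sets M" "G \<subseteq> H n" for G n
    using x[OF that] norm_triangle_ineq2[of "m G" "measure M G *\<^sub>R x n"] unfolding c_def by (simp add: algebra_simps)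
  have cm: "c n * measure M (H n) \<le> norm (m (H n)) + 2 * d * measure M (H n)" for n
    using x[OF HM order_refl, of n] norm_triangle_ineq3[of "m (H n)" "measure M (H n) *\<^sub>R x n"]
    unfolding c_def by (simp add: algebra_simps abs_le_iff)
  obtain C where C: "\<And>(A :: nat \<Rightarrow> 'b set) I. finite I \<Longrightarrow> (\<And>i. i \<in> I \<Longrightarrow> A i \<in> sets M) \<Longrightarrow>
    disjoint_family_on A I \<Longrightarrow> (\<Sum>i\<in>I. norm (m (A i))) \<le> C" using variation_bound by metis
  have summ: "summable (\<lambda>n. c n * measure M (H n))"
  proof (rule summable_comparison_test')
    have "summable (\<lambda>n. norm (m (H n)))"
      by (rule summableI_nonneg_bounded[of _ C])
         (use C HM H(2) in \<open>auto simp: disjoint_family_on_def\<close>)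
    moreover have "summable (\<lambda>n. measure M (H n))"
      using finite_measure_UNION[OF H(1,2)] by (rule sums_summable)
    ultimately show "summable (\<lambda>n. norm (m (H n)) + 2 * d * measure M (H n))"
      by (intro summable_add summable_mult)
    show "norm (c n * measure M (H n)) \<le> norm (m (H n)) + 2 * d * measure M (H n)" if "n \<ge> 0" for n
      using cm[of n] c0[of n] by (simp add: abs_mult)
  qed
  then obtain N where "norm (\<Sum>i. c (i + N) * measure M (H (i + N))) < e / 2"
    using suminf_exist_split[of "e / 2" "\<lambda>n. c n * measure M (H n)"] e by auto
  then have N: "(\<Sum>i. c (i + N) * measure M (H (i + N))) \<le> e / 2" by simp
  define t where "t = (\<lambda>w. \<Sum>i<N. indicator (H i) w *\<^sub>R x i)"
  have each: "norm (m A - integral_on A t) \<le> d * measure M A + (\<Sum>i. c (i + N) * measure M (A \<inter> H (i + N)))"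
    and summA: "summable (\<lambda>i. c (i + N) * measure M (A \<inter> H (i + N)))" if A: "A \<in> sets M" for A
  proof -
    have AH: "A \<inter> H n \<in> sets M" "A \<inter> H n \<subseteq> H n" for n using A HM by auto
    have A_sub: "A \<subseteq> space M" by (rule sets.sets_into_space[OF A])
    show s: "summable (\<lambda>i. c (i + N) * measure M (A \<inter> H (i + N)))"
    proof (rule summable_comparison_test')
      show "summable (\<lambda>i. c (i + N) * measure M (H (i + N)))"
        using summ by (rule summable_ignore_initial_segment)
      show "norm (c (i + N) * measure M (A \<inter> H (i + N))) \<le> c (i + N) * measure M (H (i + N))" if "i \<ge> 0" for i
        using c0[of "i + N"] finite_measure_mono[OF AH(2) HM] by (simp add: mult_left_mono)
    qed
    have sA: "(\<lambda>n. m (A \<inter> H n)) sums m A" by (rule ex(1)[OF A A_sub])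
    have "(\<lambda>i. m (A \<inter> H (i + N))) sums (m A - (\<Sum>i<N. m (A \<inter> H i)))"
      using sA by (simp add: sums_iff_shift[of "\<lambda>n. m (A \<inter> H n)" N])
    then have tail: "m A - (\<Sum>i<N. m (A \<inter> H i)) = (\<Sum>i. m (A \<inter> H (i + N)))" by (rule sums_unique)
    have 1: "norm (\<Sum>i. m (A \<inter> H (i + N))) \<le> (\<Sum>i. c (i + N) * measure M (A \<inter> H (i + N)))"
      by (rule norm_suminf_le[OF _ s]) (use mc AH in auto)
    have 2: "norm ((\<Sum>i<N. m (A \<inter> H i)) - integral_on A t) \<le> d * measure M A"
    proof -
      have "norm ((\<Sum>i<N. m (A \<inter> H i)) - integral_on A t)
          = norm (\<Sum>i<N. m (A \<inter> H i) - measure M (A \<inter> H i) *\<^sub>R x i)"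
        unfolding t_def by (subst integral_on_steps(2)[OF A HM]) (simp add: sum_subtractf)
      also have "\<dots> \<le> (\<Sum>i<N. d * measure M (A \<inter> H i))"
        by (rule order_trans[OF norm_sum sum_mono]) (use x AH in auto)
      also have "\<dots> = d * (\<Sum>i<N. measure M (A \<inter> H i))" by (simp add: sum_distrib_left)
      also have "\<dots> \<le> d * measure M A"
        using d sum_le_suminf[of "\<lambda>i. measure M (A \<inter> H i)" "{..<N}"] ex(2)[OF A A_sub]
        by (auto simp: sums_iff)
      finally show ?thesis .
    qed
    have 3: "m A - integral_on A t =
      ((\<Sum>i<N. m (A \<inter> H i)) - integral_on A t) + (\<Sum>i. m (A \<inter> H (i + N)))"
      using tail by (simp add: algebra_simps)
    show "norm (m A - integral_on A t) \<le> d * measure M A + (\<Sum>i. c (i + N) * measure M (A \<inter> H (i + N)))"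
      unfolding 3 by (rule order_trans[OF norm_triangle_ineq add_mono[OF 2 1]])
  qed
  have "approximates e t"
    unfolding approximates_def
  proof (intro conjI allI impI)
    show "simple_function M t" unfolding t_def by (rule integral_on_steps(1)[OF sets.top HM])
  next
    fix I :: "'a set" and A
    assume I: "finite I" "\<forall>i\<in>I. A i \<in> sets M" "disjoint_family_on A I"
    have le: "(\<Sum>i\<in>I. measure M (A i \<inter> B)) \<le> measure M B" if B: "B \<in> sets M" for B
    proof -
      have "(\<Sum>i\<in>I. measure M (A i \<inter> B)) = measure M (\<Union>i\<in>I. A i \<inter> B)"
        by (rule finite_measure_finite_Union[symmetric])
           (use I B in \<open>auto simp: disjoint_family_on_def\<close>)
      also have "\<dots> \<le> measure M B" by (rule finite_measure_mono) (use B in auto)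
      finally show ?thesis .
    qed
    have AA: "A i \<in> sets M" if "i \<in> I" for i using I that by blast
    have "(\<Sum>i\<in>I. norm (m (A i) - integral_on (A i) t)) \<le>
        (\<Sum>i\<in>I. d * measure M (A i) + (\<Sum>n. c (n + N) * measure M (A i \<inter> H (n + N))))"
      by (rule sum_mono) (use each AA in auto)
    also have "\<dots> = d * (\<Sum>i\<in>I. measure M (A i)) + (\<Sum>i\<in>I. \<Sum>n. c (n + N) * measure M (A i \<inter> H (n + N)))"
      by (simp add: sum.distrib sum_distrib_left)
    also have "(\<Sum>i\<in>I. \<Sum>n. c (n + N) * measure M (A i \<inter> H (n + N))) =
        (\<Sum>n. \<Sum>i\<in>I. c (n + N) * measure M (A i \<inter> H (n + N)))"
      by (rule suminf_sum[symmetric]) (use summA AA in auto)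
    also have "\<dots> \<le> (\<Sum>n. c (n + N) * measure M (H (n + N)))"
    proof (rule suminf_le)
      show "(\<Sum>i\<in>I. c (n + N) * measure M (A i \<inter> H (n + N))) \<le> c (n + N) * measure M (H (n + N))" for n
        using le[OF HM[of "n + N"]] c0[of "n + N"] by (simp add: sum_distrib_left[symmetric] mult_left_mono)
      show "summable (\<lambda>n. \<Sum>i\<in>I. c (n + N) * measure M (A i \<inter> H (n + N)))"
        by (rule summable_sum) (use summA AA in auto)
      show "summable (\<lambda>n. c (n + N) * measure M (H (n + N)))"
        using summ by (rule summable_ignore_initial_segment)
    qed
    finally have "(\<Sum>i\<in>I. norm (m (A i) - integral_on (A i) t))
        \<le> d * (\<Sum>i\<in>I. measure M (A i)) + (\<Sum>n. c (n + N) * measure M (H (n + N)))" by simp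
    moreover have "(\<Sum>i\<in>I. measure M (A i)) \<le> measure M (space M)"
      using le[OF sets.top] AA sets.sets_into_space by (simp add: Int_absorb2 cong: sum.cong)
    then have "d * (\<Sum>i\<in>I. measure M (A i)) \<le> d * measure M (space M)"
      using d by (simp add: mult_left_mono)
    ultimately show "(\<Sum>i\<in>I. norm (m (A i) - integral_on (A i) t)) \<le> e"
      using N dM by linarith
  qed
  then show ?thesis by blast
qed

text \<open>
  Test both approximations on the finitely many level sets of \<open>s - t\<close>: there the integral of the difference
  has norm equal to the integral of the norm.
\<close>
lemma approximates_diff:
  assumes s: "approximates a s" and t: "approximates b t"
  shows "(\<integral>\<^sup>+ w. ennreal (norm (s w - t w)) \<partial>M) \<le> ennreal (a + b)"
proof -
  define u where "u = (\<lambda>w. s w - t w)"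
  have ss: "simple_function M s" and st: "simple_function M t" using s t unfolding approximates_def by auto
  have su: "simple_function M u"
    unfolding u_def by (rule simple_function_compose2[where h = "(-)"]) (use ss st in auto)
  define A where "A = (\<lambda>y. {w \<in> space M. u w = y})"
  have A: "A y \<in> sets M" for y unfolding A_def using simple_functionD(2)[OF su, of "{y}"]
    by (simp add: vimage_def Int_def conj_commute)
  have fin: "finite (u ` space M)" using su by (rule simple_functionD(1))
  have dis: "disjoint_family_on A (u ` space M)" unfolding A_def disjoint_family_on_def by auto
  have "(\<integral>\<^sup>+ w. ennreal (norm (u w)) \<partial>M) = Bochner_Integration.simple_bochner_integral M (\<lambda>w. norm (u w))"
    by (rule simple_bochner_integral_eq_nn_integral[symmetric])
       (auto intro!: simple_bochner_integrableI simple_function_compose1[OF su])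
  also have "Bochner_Integration.simple_bochner_integral M (\<lambda>w. norm (u w)) = (\<Sum>y\<in>u ` space M. measure M (A y) *\<^sub>R norm y)"
    unfolding A_def
    by (rule simple_bochner_integral_partition[OF _ su])
       (auto intro!: simple_bochner_integrableI simple_function_compose1[OF su])
  also have "\<dots> = (\<Sum>y\<in>u ` space M. norm (integral_on (A y) s - integral_on (A y) t))"
  proof (rule sum.cong)
    fix y
    have "integral_on (A y) s - integral_on (A y) t =
        Bochner_Integration.simple_bochner_integral M (\<lambda>w. indicator (A y) w *\<^sub>R s w - indicator (A y) w *\<^sub>R t w)"
      by (rule simple_bochner_integral_diff[symmetric]; rule simple_bochner_integrableI; rule simple_function_on[OF A])
         (use ss st in auto)
    also have "\<dots> = integral_on (A y) u" unfolding u_def by (simp add: scaleR_diff_right)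
    also have "(\<lambda>w. indicator (A y) w *\<^sub>R u w) = (\<lambda>w. indicator (A y) w *\<^sub>R y)"
      by (auto simp: A_def indicator_def)
    also have "Bochner_Integration.simple_bochner_integral M \<dots> = measure M (A y) *\<^sub>R y" by (rule integral_on_const[OF A])
    finally show "measure M (A y) *\<^sub>R norm y = norm (integral_on (A y) s - integral_on (A y) t)" by simp
  qed simp
  also have "\<dots> \<le> (\<Sum>y\<in>u ` space M. norm (m (A y) - integral_on (A y) s) + norm (m (A y) - integral_on (A y) t))"
  proof (rule sum_mono)
    fix y
    show "norm (integral_on (A y) s - integral_on (A y) t)
        \<le> norm (m (A y) - integral_on (A y) s) + norm (m (A y) - integral_on (A y) t)"
      using norm_triangle_ineq4[of "m (A y) - integral_on (A y) t" "m (A y) - integral_on (A y) s"] by simp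
  qed
  also have "\<dots> \<le> a + b"
    unfolding sum.distrib by (intro add_mono approximatesD[OF s fin A dis] approximatesD[OF t fin A dis])
  finally show ?thesis unfolding u_def by (simp add: ennreal_leI)
qed

text \<open>
  Approximants with geometric errors have summable distances in \<open>L\<^sup>1\<close>, so they converge almost
  everywhere and in \<open>L\<^sup>1\<close>; their limit is the density.
\<close>
lemma density_if_approximable:
  assumes "\<And>e. 0 < e \<Longrightarrow> \<exists>t. approximates e t"
  shows "\<exists>g. \<forall>E\<in>sets M. has_strong_bochner_integral M (\<lambda>w. indicator E w *\<^sub>R g w) (m E)"
proof -
  define e where "e = (\<lambda>n. (1/4 :: real) ^ n)"
  have e0: "0 < e n" for n unfolding e_def by simp
  obtain t where t: "\<And>n. approximates (e n) (t n)" using assms[OF e0] by metis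
  have st: "simple_function M (t n)" for n using t unfolding approximates_def by blast
  define v where "v = (\<lambda>n w. norm (t (Suc n) w - t n w))"
  have [measurable]: "(\<lambda>w. ennreal (v n w)) \<in> borel_measurable M" for n
  proof -
    have "simple_function M (\<lambda>w. ennreal (v n w))"
      unfolding v_def by (rule simple_function_compose2[where h = "\<lambda>a b. ennreal (norm (a - b))"]) (auto intro: st)
    then show ?thesis by (rule borel_measurable_simple_function)
  qed
  have "e (Suc n) + e n \<le> 2 * e n" for n unfolding e_def by simp
  then have int_v: "(\<integral>\<^sup>+ w. ennreal (v n w) \<partial>M) \<le> ennreal (2 * e n)" for n
    unfolding v_def using approximates_diff[OF t[of "Suc n"] t[of n]] ennreal_leI order_trans by blast
  have e_sums: "(\<lambda>k. 2 * e (k + n)) sums (8/3 * e n)" for n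
  proof -
    have "(\<lambda>k. (1/4 :: real) ^ k) sums (1 / (1 - 1/4))" by (rule geometric_sums) simp
    from sums_mult[OF this, of "2 * e n"] show ?thesis by (simp add: e_def power_add mult_ac)
  qed
  have tail: "(\<integral>\<^sup>+ w. (\<Sum>k. ennreal (v (k + n) w)) \<partial>M) \<le> ennreal (8/3 * e n)" for n
  proof -
    have "(\<integral>\<^sup>+ w. (\<Sum>k. ennreal (v (k + n) w)) \<partial>M) = (\<Sum>k. \<integral>\<^sup>+ w. ennreal (v (k + n) w) \<partial>M)"
      by (rule nn_integral_suminf) simp
    also have "\<dots> \<le> (\<Sum>k. ennreal (2 * e (k + n)))" by (rule suminf_le) (auto intro: int_v)
    also have "\<dots> = ennreal (8/3 * e n)"
      by (rule suminf_ennreal_eq[OF _ e_sums]) (simp add: e0 less_imp_le)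
    finally show ?thesis .
  qed
  have "AE w in M. (\<Sum>k. ennreal (v k w)) \<noteq> \<infinity>"
    by (rule nn_integral_PInf_AE) (use tail[of 0] in \<open>auto simp: top_unique\<close>)
  then have AE_summ: "AE w in M. summable (\<lambda>k. v k w)"
  proof (rule AE_mp, intro AE_I2 impI)
    fix w assume "(\<Sum>k. ennreal (v k w)) \<noteq> \<infinity>"
    then show "summable (\<lambda>k. v k w)" by (intro summable_suminf_not_top) (auto simp: v_def)
  qed
  define g where "g = (\<lambda>w. lim (\<lambda>n. t n w))"
  have conv: "(\<lambda>n. t n w) \<longlonglongrightarrow> g w" and dist: "norm (g w - t n w) \<le> (\<Sum>k. v (k + n) w)"
    if s: "summable (\<lambda>k. v k w)" for w n
  proof -
    have sd: "summable (\<lambda>k. t (Suc k) w - t k w)"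
      by (rule summable_norm_cancel) (use s in \<open>simp add: v_def\<close>)
    have "(\<lambda>n. (\<Sum>k<n. t (Suc k) w - t k w) + t 0 w) \<longlonglongrightarrow> (\<Sum>k. t (Suc k) w - t k w) + t 0 w"
      by (intro tendsto_add summable_LIMSEQ sd tendsto_const)
    then have "convergent (\<lambda>n. t n w)"
      unfolding sum_lessThan_telescope[of "\<lambda>k. t k w"] convergent_def by auto
    then show *: "(\<lambda>n. t n w) \<longlonglongrightarrow> g w" unfolding g_def by (simp add: convergent_LIMSEQ_iff)
    have "(\<lambda>k. t (Suc k + n) w - t (k + n) w) sums (g w - t (0 + n) w)"
      using telescope_sums[OF LIMSEQ_ignore_initial_segment[OF *, of n]] by simp
    then have "g w - t n w = (\<Sum>k. t (Suc k + n) w - t (k + n) w)" by (simp add: sums_iff)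
    also have "norm \<dots> \<le> (\<Sum>k. norm (t (Suc k + n) w - t (k + n) w))"
      by (rule summable_norm) (use summable_ignore_initial_segment[OF s, of n] in \<open>simp add: v_def\<close>)
    finally show "norm (g w - t n w) \<le> (\<Sum>k. v (k + n) w)" by (simp add: v_def)
  qed
  have L1: "(\<integral>\<^sup>+ w. ennreal (norm (indicator E w *\<^sub>R g w - indicator E w *\<^sub>R t n w)) \<partial>M) \<le> ennreal (8/3 * e n)" for E n
  proof -
    have "AE w in M. ennreal (norm (indicator E w *\<^sub>R g w - indicator E w *\<^sub>R t n w)) \<le> (\<Sum>k. ennreal (v (k + n) w))"
      using AE_summ
    proof (rule AE_mp, intro AE_I2 impI)
      fix w assume s: "summable (\<lambda>k. v k w)"
      have "norm (indicator E w *\<^sub>R g w - indicator E w *\<^sub>R t n w) \<le> norm (g w - t n w)"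
        by (cases "w \<in> E") simp_all
      also have "\<dots> \<le> (\<Sum>k. v (k + n) w)" by (rule dist[OF s])
      finally have "ennreal (norm (indicator E w *\<^sub>R g w - indicator E w *\<^sub>R t n w)) \<le> ennreal (\<Sum>k. v (k + n) w)"
        by (rule ennreal_leI)
      also have "\<dots> = (\<Sum>k. ennreal (v (k + n) w))"
        by (rule suminf_ennreal2[symmetric]) (use summable_ignore_initial_segment[OF s, of n] in \<open>auto simp: v_def\<close>)
      finally show "ennreal (norm (indicator E w *\<^sub>R g w - indicator E w *\<^sub>R t n w)) \<le> (\<Sum>k. ennreal (v (k + n) w))" .
    qed
    then show ?thesis by (rule order_trans[OF nn_integral_mono_AE tail])
  qed
  have e_to0: "e \<longlonglongrightarrow> 0" unfolding e_def by (rule LIMSEQ_power_zero) simp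
  have "has_strong_bochner_integral M (\<lambda>w. indicator E w *\<^sub>R g w) (m E)" if E: "E \<in> sets M" for E
  proof -
    define s where "s = (\<lambda>n w. indicator E w *\<^sub>R t n w)"
    have simple: "simple_function M (s n)" for n unfolding s_def by (rule simple_function_on[OF E st])
    have "AE w in M. (\<lambda>n. s n w) \<longlonglongrightarrow> indicator E w *\<^sub>R g w"
      using AE_summ unfolding s_def by (rule AE_mp) (intro AE_I2 impI tendsto_scaleR tendsto_const conv)
    with simple have 1: "strongly_measurable M (\<lambda>w. indicator E w *\<^sub>R g w)"
      unfolding strongly_measurable_def by blast
    have "(\<lambda>n. ennreal (8/3 * e n)) \<longlonglongrightarrow> ennreal (8/3 * 0)"
      by (intro tendsto_ennrealI tendsto_mult_left e_to0)
    then have lim: "(\<lambda>n. ennreal (8/3 * e n)) \<longlonglongrightarrow> 0" by simp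
    have 2: "(\<lambda>n. \<integral>\<^sup>+ w. ennreal (norm (indicator E w *\<^sub>R g w - s n w)) \<partial>M) \<longlonglongrightarrow> 0"
    proof (rule tendsto_sandwich[OF _ _ tendsto_const lim])
      show "\<forall>\<^sub>F n in sequentially. (\<integral>\<^sup>+ w. ennreal (norm (indicator E w *\<^sub>R g w - s n w)) \<partial>M) \<le> ennreal (8/3 * e n)"
        unfolding s_def using L1 by simp
    qed simp
    have "norm (Bochner_Integration.simple_bochner_integral M (s n) - m E) \<le> e n" for n
    proof -
      have "(\<Sum>i\<in>{0::'a}. norm (m E - integral_on E (t n))) \<le> e n"
        by (rule approximatesD[OF t]) (simp_all add: E disjoint_family_on_def)
      then show ?thesis unfolding s_def by (simp add: norm_minus_commute)
    qed
    then have "(\<lambda>n. Bochner_Integration.simple_bochner_integral M (s n) - m E) \<longlonglongrightarrow> 0"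
      by (intro Lim_null_comparison[OF _ e_to0]) simp
    then have 3: "(\<lambda>n. Bochner_Integration.simple_bochner_integral M (s n)) \<longlonglongrightarrow> m E" by (rule LIM_zero_cancel)
    have 4: "Bochner_Integration.simple_bochner_integrable M (s n)" for n
      by (rule simple_bochner_integrableI[OF simple])
    show ?thesis
      unfolding has_strong_bochner_integral_def
      by (rule conjI[OF 1], rule exI[of _ s], rule conjI[OF allI[OF 4] conjI[OF 2 3]])
  qed
  then show ?thesis by (intro exI[of _ g] ballI)
qed

end

section \<open>A tree of averages without weakly strongly exposed points\<close>

lemma convex_hull_uminus_closed:
  fixes V :: "'v::real_vector set"
  assumes "x \<in> convex hull (V \<union> uminus ` V)"
  shows "- x \<in> convex hull (V \<union> uminus ` V)"
proof -
  have "uminus ` (convex hull (V \<union> uminus ` V)) = convex hull (uminus ` (V \<union> uminus ` V))"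
    by (rule convex_hull_linear_image[OF linear_uminus])
  also have "uminus ` (V \<union> uminus ` V) = V \<union> uminus ` V" by (simp add: image_Un image_image Un_commute)
  finally show ?thesis using assms by blast
qed

lemma finite_net_of_convex_hull:
  fixes V :: "'v::real_normed_vector set"
  assumes "finite V" "0 < d"
  shows "\<exists>Y. finite Y \<and> (\<forall>x\<in>convex hull (V \<union> uminus ` V). \<exists>y\<in>Y. norm (x - y) < d)"
proof -
  have "seq_compact (convex hull (V \<union> uminus ` V))"
    by (rule compact_imp_seq_compact[OF finite_imp_compact_convex_hull]) (use assms in simp)
  from seq_compact_imp_totally_bounded[OF this] assms(2)
  obtain Y where "finite Y" "convex hull (V \<union> uminus ` V) \<subseteq> (\<Union>x\<in>Y. ball x d)" by meson
  then show ?thesis by (intro exI[of _ Y]) (fastforce simp: dist_norm norm_minus_commute)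
qed

context continuous_vector_measure
begin

text \<open>
  A half-space at distance at least \<open>r\<close> from \<open>y\<close> contains the averages of \<open>m\<close> over all non-null subsets of \<open>G\<close>.
\<close>
definition escapes :: "real \<Rightarrow> 'a \<Rightarrow> 'b set \<Rightarrow> bool" where
  "escapes r y G \<longleftrightarrow> (\<exists>\<psi> :: 'a \<Rightarrow>\<^sub>L real. norm \<psi> \<le> 1 \<and>
     (\<forall>H\<in>sets M. H \<subseteq> G \<longrightarrow> (blinfun_apply \<psi> y + r) * measure M H \<le> \<psi> (m H)))"

lemma escapes_mono: "escapes r y G \<Longrightarrow> H \<subseteq> G \<Longrightarrow> escapes r y H"
  unfolding escapes_def by (meson order_trans)

text \<open>
  With \<open>\<psi>\<close> norming \<open>m E - measure M E *\<^sub>R y\<close>, the real measure \<open>\<psi> \<circ> m - (\<psi> y + r) \<mu>\<close> is positive on \<open>E\<close>; \<open>G\<close> is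
  a part of \<open>E\<close> on which it is a positive measure, as in the Hahn decomposition.
\<close>
lemma escaping_piece:
  assumes E: "E \<in> sets M" and far: "r * measure M E < norm (m E - measure M E *\<^sub>R y)"
  shows "\<exists>G\<in>sets M. G \<subseteq> E \<and> 0 < measure M G \<and> escapes r y G"
proof -
  obtain \<psi> :: "'a \<Rightarrow>\<^sub>L real" where \<psi>: "norm \<psi> \<le> 1"
    "\<psi> (m E - measure M E *\<^sub>R y) = norm (m E - measure M E *\<^sub>R y)"
    using exists_norming_functional by blast
  have big: "(\<psi> y + r) * measure M E < \<psi> (m E)"
    using far unfolding \<psi>(2)[symmetric] by (simp add: blinfun.diff_right blinfun.scaleR_right algebra_simps)
  have "\<exists>G\<in>sets M. G \<subseteq> E \<and> 0 < measure M G \<and>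
      (\<forall>H\<in>sets M. H \<subseteq> G \<longrightarrow> 0 < measure M H \<longrightarrow> \<not> \<psi> (m H) \<le> (\<psi> y + r) * measure M H)"
  proof (rule ccontr)
    assume "\<not> ?thesis"
    then have ex: "\<exists>H\<in>sets M. H \<subseteq> G \<and> 0 < measure M H \<and> \<psi> (m H) \<le> (\<psi> y + r) * measure M H"
      if "G \<in> sets M" "G \<subseteq> E" "0 < measure M G" for G using that by blast
    have "\<psi> (m {}) \<le> (\<psi> y + r) * measure M {}" by simp
    from exhaustion[OF E, of "\<lambda>H. \<psi> (m H) \<le> (\<psi> y + r) * measure M H", OF this ex]
    obtain H :: "nat \<Rightarrow> 'b set" where H: "range H \<subseteq> sets M" "disjoint_family H"
      "\<And>n. H n \<subseteq> E" "\<And>n. \<psi> (m (H n)) \<le> (\<psi> y + r) * measure M (H n)" "measure M (E - (\<Union>n. H n)) = 0"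
      by auto
    have EH: "E \<inter> H n = H n" for n using H(3)[of n] by blast
    have 1: "(\<lambda>n. m (H n)) sums m E" and 2: "(\<lambda>n. measure M (H n)) sums measure M E"
      using sums_exhausted[OF H(1,2) E H(5) E] unfolding EH by auto
    have "\<psi> (m E) \<le> (\<psi> y + r) * measure M E"
      by (rule sums_le[OF H(4) bounded_linear.sums[OF blinfun.bounded_linear_right 1] sums_mult[OF 2]])
    with big show False by simp
  qed
  then obtain G where G: "G \<in> sets M" "G \<subseteq> E" "0 < measure M G"
    "\<And>H. H \<in> sets M \<Longrightarrow> H \<subseteq> G \<Longrightarrow> 0 < measure M H \<Longrightarrow> \<not> \<psi> (m H) \<le> (\<psi> y + r) * measure M H" by blast
  have "(\<psi> y + r) * measure M H \<le> \<psi> (m H)" if "H \<in> sets M" "H \<subseteq> G" for H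
    using G(4)[OF that] m_null[OF that(1)] by (cases "measure M H = 0") (auto simp: zero_less_measure_iff)
  then have "escapes r y G" unfolding escapes_def using \<psi>(1) by blast
  then show ?thesis using G(1,2,3) by blast
qed

definition avg :: "'b set \<Rightarrow> 'a" where
  "avg G = (1 / measure M G) *\<^sub>R m G"

end

locale nowhere_nearly_constant = continuous_vector_measure M m
  for M :: "'b measure" and m :: "'b set \<Rightarrow> 'a::banach" +
  fixes E :: "'b set" and r L :: real
  assumes E: "E \<in> sets M" "0 < measure M E" and r: "0 < r"
    and lipschitz: "\<And>H. H \<in> sets M \<Longrightarrow> H \<subseteq> E \<Longrightarrow> norm (m H) \<le> L * measure M H"
    and nowhere: "\<And>G. G \<in> sets M \<Longrightarrow> G \<subseteq> E \<Longrightarrow> 0 < measure M G \<Longrightarrow> \<not> nearly_constant r G"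
begin

lemma escaping_piece_finite:
  assumes "finite Y" "G \<in> sets M" "G \<subseteq> E" "0 < measure M G"
  shows "\<exists>H\<in>sets M. H \<subseteq> G \<and> 0 < measure M H \<and> (\<forall>y\<in>Y. escapes r y H)"
  using assms
proof (induction Y rule: finite_induct)
  case (insert y Y)
  then obtain H where H: "H \<in> sets M" "H \<subseteq> G" "0 < measure M H" "\<forall>y\<in>Y. escapes r y H" by blast
  have "\<not> nearly_constant r H" using nowhere[of H] H insert.prems by blast
  then obtain H' where H': "H' \<in> sets M" "H' \<subseteq> H" "r * measure M H' < norm (m H' - measure M H' *\<^sub>R y)"
    unfolding nearly_constant_def by (meson not_le)
  obtain G' where G': "G' \<in> sets M" "G' \<subseteq> H'" "0 < measure M G'" "escapes r y G'"
    using escaping_piece[OF H'(1,3)] by blast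
  have "\<forall>z\<in>Y. escapes r z G'" using H(4) H'(2) G'(2) escapes_mono by (meson order_trans)
  then show ?case using G' H'(2) H(2) by (intro bexI[of _ G']) auto
qed auto

lemma refine_partition:
  assumes P: "finite P" "\<And>G. G \<in> P \<Longrightarrow> G \<in> sets M \<and> G \<subseteq> E" and Y: "finite Y" and e: "0 < e"
  shows "\<exists>P'. finite P' \<and> disjoint P' \<and>
    (\<forall>G\<in>P'. G \<in> sets M \<and> 0 < measure M G \<and> (\<exists>G0\<in>P. G \<subseteq> G0) \<and> (\<forall>y\<in>Y. escapes r y G)) \<and>
    measure M (\<Union>P - \<Union>P') \<le> e"
proof -
  define Q where "Q = (\<lambda>H. H = {} \<or> (\<exists>G0\<in>P. H \<subseteq> G0) \<and> (\<forall>y\<in>Y. escapes r y H))"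
  have PM: "\<Union>P \<in> sets M" using P by (auto intro: sets.finite_Union)
  have ex: "\<exists>H\<in>sets M. H \<subseteq> G \<and> 0 < measure M H \<and> Q H" if G: "G \<in> sets M" "G \<subseteq> \<Union>P" "0 < measure M G" for G
  proof -
    have "\<exists>G0\<in>P. 0 < measure M (G \<inter> G0)"
    proof (rule ccontr)
      assume "\<not> ?thesis"
      then have 0: "measure M (G \<inter> G0) = 0" if "G0 \<in> P" for G0 using that by (simp add: zero_less_measure_iff)
      have "G = (\<Union>G0\<in>P. G \<inter> G0)" using G(2) by blast
      then have "measure M G \<le> (\<Sum>G0\<in>P. measure M (G \<inter> G0))"
        using finite_measure_subadditive_finite[OF P(1), of "\<lambda>G0. G \<inter> G0"] P(2) G(1) by force
      with 0 G(3) show False by simp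
    qed
    then obtain G0 where G0: "G0 \<in> P" "0 < measure M (G \<inter> G0)" by blast
    obtain H where "H \<in> sets M" "H \<subseteq> G \<inter> G0" "0 < measure M H" "\<forall>y\<in>Y. escapes r y H"
      using escaping_piece_finite[OF Y, of "G \<inter> G0"] G0 G(1) P(2)[OF G0(1)] by blast
    then show ?thesis using G0(1) unfolding Q_def by blast
  qed
  have "Q {}" unfolding Q_def by simp
  from exhaustion[of "\<Union>P" Q, OF PM this ex] obtain H :: "nat \<Rightarrow> 'b set" where
    H: "range H \<subseteq> sets M" "disjoint_family H" "\<And>n. H n \<subseteq> \<Union>P" "\<And>n. Q (H n)"
      "measure M (\<Union>P - (\<Union>n. H n)) = 0"
    by auto
  have HM: "H n \<in> sets M" for n using H(1) by auto
  have EH: "\<Union>P \<inter> H n = H n" for n using H(3)[of n] by blast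
  have "(\<lambda>n. measure M (H n)) sums measure M (\<Union>P)"
    using sums_exhausted(2)[OF H(1,2) PM H(5) PM order_refl] unfolding EH .
  then have "(\<lambda>n. \<Sum>i<n. measure M (H i)) \<longlonglongrightarrow> measure M (\<Union>P)" unfolding sums_def .
  from order_tendstoD(1)[OF this, of "measure M (\<Union>P) - e"] e
  obtain N where N: "measure M (\<Union>P) - e < (\<Sum>i<N. measure M (H i))"
    by (auto simp: eventually_sequentially)
  define I where "I = {i. i < N \<and> 0 < measure M (H i)}"
  have fin: "finite I" unfolding I_def by simp
  have ne: "H i \<noteq> {}" if "i \<in> I" for i using that unfolding I_def by auto
  have "measure M (\<Union>(H ` I)) = (\<Sum>i\<in>I. measure M (H i))"
    by (rule finite_measure_finite_Union[OF fin])
       (use HM H(2) in \<open>auto simp: disjoint_family_on_def\<close>)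
  also have "\<dots> = (\<Sum>i<N. measure M (H i))"
    by (rule sum.mono_neutral_left) (auto simp: I_def zero_less_measure_iff)
  finally have UI: "measure M (\<Union>(H ` I)) = (\<Sum>i<N. measure M (H i))" .
  have UIM: "\<Union>(H ` I) \<in> sets M" using HM fin by auto
  have sub: "\<Union>(H ` I) \<subseteq> \<Union>P" using H(3) by blast
  have "measure M (\<Union>P - \<Union>(H ` I)) = measure M (\<Union>P) - measure M (\<Union>(H ` I))"
    by (rule finite_measure_Diff[OF PM UIM sub])
  then have "measure M (\<Union>P - \<Union>(H ` I)) \<le> e" using UI N by simp
  moreover have "disjoint (H ` I)"
    by (rule disjoint_family_on_disjoint_image) (use H(2) in \<open>auto simp: disjoint_family_on_def\<close>)
  moreover have "\<forall>G\<in>H ` I. G \<in> sets M \<and> 0 < measure M G \<and> (\<exists>G0\<in>P. G \<subseteq> G0) \<and> (\<forall>y\<in>Y. escapes r y G)"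
  proof
    fix G assume "G \<in> H ` I"
    then obtain i where i: "i \<in> I" "G = H i" by blast
    then show "G \<in> sets M \<and> 0 < measure M G \<and> (\<exists>G0\<in>P. G \<subseteq> G0) \<and> (\<forall>y\<in>Y. escapes r y G)"
      using HM[of i] H(4)[of i] ne[OF i(1)] unfolding Q_def I_def by simp
  qed
  ultimately show ?thesis using fin by (intro exI[of _ "H ` I"] conjI finite_imageI)
qed

text \<open>
  The vertices of the tree are the averages of \<open>m\<close> over \<open>G \<inter> \<Omega>\<close>, where \<open>G\<close> runs through finite partitions \<open>P n\<close> and \<open>\<Omega>\<close>
  is the part of \<open>E\<close> that no refinement discards. Each vertex is a convex combination of its children. For each
  point of a finite net of the hull of level \<open>n\<close>, all vertices below a given set in \<open>P (Suc n)\<close> lie in a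
  half-space at distance at least \<open>r\<close> from that point, and \<open>P (Suc n)\<close> is finite. So a point \<open>k\<close> of the
  closure, being close to the hull of some level, has a weak neighbourhood that no later vertex enters, while
  the later vertices still determine every supremum.

  Refinement covers a finite partition only up to a small set, and \<open>\<Omega>\<close> is not known when the nets are
  chosen. Hence the losses after stage \<open>n\<close> are kept so small relative to every \<open>G\<close> in \<open>P n\<close> that replacing
  \<open>G\<close> by \<open>G \<inter> \<Omega>\<close> moves its average by at most \<open>r / 4\<close>.
\<close>
theorem exists_set_with_escaping_slices:
  "\<exists>K :: 'a set. symmetric_convex K \<and> (\<exists>B. \<forall>a\<in>K. norm a \<le> B) \<and>
     (\<forall>k\<in>closure K. \<exists>\<Psi> :: ('a \<Rightarrow>\<^sub>L real) set. finite \<Psi> \<and>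
        (\<forall>(f :: 'a \<Rightarrow>\<^sub>L real). \<forall>a\<in>K. \<exists>v\<in>K. f a \<le> f v \<and> (\<exists>\<psi>\<in>\<Psi>. r / 2 \<le> \<bar>blinfun_apply \<psi> v - \<psi> k\<bar>)))"
proof -
  have "0 \<le> L * measure M E" using lipschitz[OF E(1) order_refl] norm_ge_zero order_trans by blast
  then have L0: "0 \<le> L" using E(2) by (simp add: zero_le_mult_iff)
  \<comment> \<open>Removing a part of relative measure \<open>c\<close> from a set moves its average by at most \<open>2 * L * c\<close>.\<close>
  define c where "c = r / (8 * (L + r))"
  have c: "0 < c" "c < 1" "2 * L * c \<le> r / 4"
    unfolding c_def using r L0 by (auto simp: field_simps)
  have "\<exists>Y. finite V \<longrightarrow> finite Y \<and> (\<forall>x\<in>convex hull (V \<union> uminus ` V). \<exists>y\<in>Y. norm (x - y) < r / 8)" for V :: "'a set"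
    using finite_net_of_convex_hull[of V "r / 8"] r by auto
  then obtain net :: "'a set \<Rightarrow> 'a set" where net: "\<And>V. finite V \<Longrightarrow> finite (net V)"
    "\<And>V x. finite V \<Longrightarrow> x \<in> convex hull (V \<union> uminus ` V) \<Longrightarrow> \<exists>y\<in>net V. norm (x - y) < r / 8"
    by metis
  \<comment> \<open>A stage consists of a partition and of the measure \<open>\<eta>\<close> that the next refinement may lose. As \<open>\<eta>\<close> is
    halved in each step, the total loss from a stage on is at most \<open>2 * \<eta>\<close>.\<close>
  define inv where "inv = (\<lambda>(n::nat) (P, \<eta>). finite P \<and> disjoint P \<and>
    (\<forall>G\<in>P. G \<in> sets M \<and> G \<subseteq> E \<and> 0 < measure M G \<and> 2 * \<eta> \<le> c * measure M G) \<and> 0 < \<eta> \<and> (n = 0 \<longrightarrow> P = {E}))"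
  define step where "step = (\<lambda>(n::nat) (P, \<eta>) (P', \<eta>' :: real). (\<forall>G\<in>P'. \<exists>G0\<in>P. G \<subseteq> G0) \<and>
    (\<forall>G\<in>P'. \<forall>y\<in>net (avg ` P). escapes r y G) \<and> \<eta>' \<le> \<eta> / 2 \<and> measure M (\<Union>P - \<Union>P') \<le> (\<eta> :: real))"
  have "\<exists>S. \<forall>n. inv n (S n) \<and> step n (S n) (S (Suc n))"
  proof (rule dependent_nat_choice)
    show "\<exists>S. inv 0 S"
      by (rule exI[of _ "({E}, c * measure M E / 2)"]) (use E c in \<open>simp add: inv_def disjoint_def\<close>)
  next
    fix S n assume "inv n S"
    moreover obtain P \<eta> where S: "S = (P, \<eta>)" by (cases S)
    ultimately have P: "finite P" "\<And>G. G \<in> P \<Longrightarrow> G \<in> sets M \<and> G \<subseteq> E" "0 < \<eta>"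
      unfolding inv_def by auto
    from refine_partition[OF P(1,2) net(1) P(3), of "avg ` P"] P(1)
    obtain P' where P': "finite P'" "disjoint P'" "measure M (\<Union>P - \<Union>P') \<le> \<eta>"
      "\<And>G. G \<in> P' \<Longrightarrow> G \<in> sets M \<and> 0 < measure M G \<and> (\<exists>G0\<in>P. G \<subseteq> G0) \<and> (\<forall>y\<in>net (avg ` P). escapes r y G)"
      by auto
    define \<eta>' where "\<eta>' = Min (insert (\<eta> / 2) ((\<lambda>G. c * measure M G / 2) ` P'))"
    have "\<eta>' \<in> insert (\<eta> / 2) ((\<lambda>G. c * measure M G / 2) ` P')"
      unfolding \<eta>'_def by (rule Min_in) (use P'(1) in auto)
    then have pos: "0 < \<eta>'" using P(3) P'(4) c(1) by auto
    have le: "\<eta>' \<le> \<eta> / 2" unfolding \<eta>'_def by (rule Min_le) (use P'(1) in auto)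
    have le': "2 * \<eta>' \<le> c * measure M G" if "G \<in> P'" for G
    proof -
      have "\<eta>' \<le> c * measure M G / 2" unfolding \<eta>'_def by (rule Min_le) (use P'(1) that in auto)
      then show ?thesis by simp
    qed
    have sub: "G \<subseteq> E" if "G \<in> P'" for G using P'(4)[OF that] P(2) by blast
    have "inv (Suc n) (P', \<eta>')" unfolding inv_def using P'(1,2,4) pos le' sub by auto
    moreover have "step n S (P', \<eta>')" unfolding step_def S using P'(3,4) le by auto
    ultimately show "\<exists>S'. inv (Suc n) S' \<and> step n S S'" by blast
  qed
  then obtain S where S: "\<And>n. inv n (S n)" "\<And>n. step n (S n) (S (Suc n))" by blast
  define P where "P = (\<lambda>n. fst (S n))"
  define \<eta> where "\<eta> = (\<lambda>n. snd (S n))"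
  have Sn: "S n = (P n, \<eta> n)" for n unfolding P_def \<eta>_def by simp
  have fin: "finite (P n)" and dis: "disjoint (P n)" and \<eta>0: "0 < \<eta> n" for n
    using S(1)[of n] unfolding Sn inv_def by auto
  have PM: "G \<in> sets M" and PE: "G \<subseteq> E" and Ppos: "0 < measure M G" and P\<eta>: "2 * \<eta> n \<le> c * measure M G"
    if "G \<in> P n" for G n using S(1)[of n] that unfolding Sn inv_def by auto
  have P0: "P 0 = {E}" using S(1)[of 0] unfolding Sn inv_def by auto
  have parent: "\<exists>G0\<in>P n. G \<subseteq> G0" and esc: "y \<in> net (avg ` P n) \<Longrightarrow> escapes r y G" if "G \<in> P (Suc n)" for G n y
    using S(2)[of n] that unfolding Sn step_def by auto
  have \<eta>_half: "\<eta> (Suc n) \<le> \<eta> n / 2" and loss: "measure M (\<Union>(P n) - \<Union>(P (Suc n))) \<le> \<eta> n" for n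
    using S(2)[of n] unfolding Sn step_def by auto
  have UPM: "\<Union>(P n) \<in> sets M" for n using fin PM by (auto intro: sets.finite_Union)
  have dec: "\<Union>(P (n + k)) \<subseteq> \<Union>(P n)" for n k
  proof (induction k)
    case (Suc k)
    have "\<Union>(P (Suc (n + k))) \<subseteq> \<Union>(P (n + k))" using parent by blast
    then show ?case using Suc by simp
  qed simp
  have ancestor: "\<exists>G0\<in>P n. G \<subseteq> G0" if "G \<in> P (n + k)" for G n k
    using that
  proof (induction k arbitrary: G)
    case (Suc k)
    then obtain G1 where "G1 \<in> P (n + k)" "G \<subseteq> G1" using parent[of G "n + k"] by auto
    then show ?case using Suc.IH by (meson order_trans)
  qed auto
  define \<Omega> where "\<Omega> = (\<Inter>n. \<Union>(P n))"
  have \<Omega>M: "\<Omega> \<in> sets M" unfolding \<Omega>_def using UPM by auto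
  have lost: "measure M (G - \<Omega>) \<le> c * measure M G" if G: "G \<in> P n" for G n
  proof -
    let ?D = "\<lambda>k. \<Union>(P (n + k)) - \<Union>(P (Suc (n + k)))"
    have \<eta>k: "\<eta> (n + k) \<le> \<eta> n * (1/2) ^ k" for k
    proof (induction k)
      case (Suc k)
      then show ?case using \<eta>_half[of "n + k"] by simp
    qed simp
    have geo: "(\<lambda>k. \<eta> n * (1/2) ^ k) sums (\<eta> n * 2)"
      using sums_mult[OF geometric_sums[of "1/2 :: real"], of "\<eta> n"] by simp
    have Dle: "measure M (?D k) \<le> \<eta> n * (1/2) ^ k" for k
      using loss[of "n + k"] \<eta>k[of k] by simp
    have summ: "summable (\<lambda>k. measure M (?D k))"
      by (rule summable_comparison_test'[OF sums_summable[OF geo]]) (use Dle in simp)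
    have "G - \<Omega> \<subseteq> (\<Union>k. ?D k)"
    proof
      fix x assume x: "x \<in> G - \<Omega>"
      then have x0: "x \<in> \<Union>(P (n + 0))" using G by auto
      obtain j where j: "x \<notin> \<Union>(P j)" using x unfolding \<Omega>_def by auto
      have "n \<le> j"
      proof (rule ccontr)
        assume "\<not> n \<le> j"
        then have "\<Union>(P n) \<subseteq> \<Union>(P j)" using dec[of j "n - j"] by simp
        with j x0 show False by auto
      qed
      then have "x \<notin> \<Union>(P (n + (j - n)))" using j by simp
      moreover have "x \<in> \<Union>(P (n + i))" if "\<And>k. x \<in> \<Union>(P (n + k)) \<Longrightarrow> x \<in> \<Union>(P (n + Suc k))" for i
        by (induction i) (use x0 that in blast)+
      ultimately obtain k where "x \<in> \<Union>(P (n + k))" "x \<notin> \<Union>(P (n + Suc k))" by metis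
      then show "x \<in> (\<Union>k. ?D k)" by auto
    qed
    then have "measure M (G - \<Omega>) \<le> measure M (\<Union>k. ?D k)"
      by (rule finite_measure_mono) (use UPM in auto)
    also have "\<dots> \<le> (\<Sum>k. measure M (?D k))"
      by (rule finite_measure_subadditive_countably[OF _ summ]) (use UPM in auto)
    also have "\<dots> \<le> (\<Sum>k. \<eta> n * (1/2) ^ k)"
      by (rule suminf_le[OF Dle summ sums_summable[OF geo]])
    also have "\<dots> = 2 * \<eta> n" using sums_unique[OF geo] by simp
    also have "\<dots> \<le> c * measure M G" by (rule P\<eta>[OF G])
    finally show ?thesis .
  qed
  have split_meas: "measure M G = measure M (G \<inter> \<Omega>) + measure M (G - \<Omega>)" if "G \<in> sets M" for G
    using finite_measure_Union[of "G \<inter> \<Omega>" "G - \<Omega>"] that \<Omega>M by (simp add: Int_Diff_Un Int_Diff_disjoint)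
  have pos: "0 < measure M (G \<inter> \<Omega>)" if G: "G \<in> P n" for G n
  proof -
    have "c * measure M G < measure M G" using c(2) Ppos[OF G] by simp
    then show ?thesis using lost[OF G] split_meas[OF PM[OF G]] by linarith
  qed
  define a where "a = (\<lambda>G. avg (G \<inter> \<Omega>))"
  have m_a: "m (G \<inter> \<Omega>) = measure M (G \<inter> \<Omega>) *\<^sub>R a G" if "G \<in> P n" for G n
    using pos[OF that] unfolding a_def avg_def by simp
  have a_norm: "norm (a G) \<le> L" if G: "G \<in> P n" for G n
  proof -
    have "norm (m (G \<inter> \<Omega>)) \<le> L * measure M (G \<inter> \<Omega>)"
      by (rule lipschitz) (use PM[OF G] \<Omega>M PE[OF G] in auto)
    then show ?thesis using pos[OF G] unfolding a_def avg_def by (simp add: field_simps)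
  qed
  have a_avg: "norm (a G - avg G) \<le> r / 4" if G: "G \<in> P n" for G n
  proof -
    define q where "q = measure M (G - \<Omega>) / measure M G"
    have q: "0 \<le> q" "q \<le> c" unfolding q_def using lost[OF G] Ppos[OF G] by (auto simp: field_simps)
    have "norm (m (G - \<Omega>)) \<le> L * measure M (G - \<Omega>)"
      by (rule lipschitz) (use PM[OF G] \<Omega>M PE[OF G] in auto)
    then have 1: "norm ((1 / measure M G) *\<^sub>R m (G - \<Omega>)) \<le> L * q"
      unfolding q_def using Ppos[OF G] by (simp add: field_simps)
    have "measure M (G \<inter> \<Omega>) / measure M G = 1 - q"
      unfolding q_def using split_meas[OF PM[OF G]] Ppos[OF G] by (simp add: field_simps)
    then have "avg G = (1 - q) *\<^sub>R a G + (1 / measure M G) *\<^sub>R m (G - \<Omega>)"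
      using m_split[OF PM[OF G] \<Omega>M] m_a[OF G] unfolding avg_def by (simp add: scaleR_add_right)
    then have "a G - avg G = q *\<^sub>R a G - (1 / measure M G) *\<^sub>R m (G - \<Omega>)"
      by (simp add: algebra_simps)
    then have "norm (a G - avg G) \<le> norm (q *\<^sub>R a G) + norm ((1 / measure M G) *\<^sub>R m (G - \<Omega>))"
      by (simp only: norm_triangle_ineq4)
    moreover have "norm (q *\<^sub>R a G) \<le> q * L" using q(1) a_norm[OF G] by (simp add: mult_left_mono)
    moreover have "q * L \<le> c * L" using q(2) L0 by (simp add: mult_right_mono)
    ultimately show ?thesis using 1 c(3) by (simp add: mult.commute)
  qed
  define level where "level = (\<lambda>n. a ` P n)"
  define body where "body = (\<lambda>n. convex hull (level n \<union> uminus ` level n))"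
  have children: "a G \<in> convex hull (level (Suc n))" if G: "G \<in> P n" for G n
  proof -
    define Q where "Q = {G' \<in> P (Suc n). G' \<subseteq> G}"
    have finQ: "finite Q" unfolding Q_def using fin by simp
    have QP: "G' \<in> P (Suc n)" if "G' \<in> Q" for G' using that unfolding Q_def by simp
    have "G \<inter> \<Omega> \<subseteq> (\<Union>G'\<in>Q. G' \<inter> \<Omega>)"
    proof
      fix x assume x: "x \<in> G \<inter> \<Omega>"
      then obtain G' where G': "G' \<in> P (Suc n)" "x \<in> G'" unfolding \<Omega>_def by blast
      obtain G0 where G0: "G0 \<in> P n" "G' \<subseteq> G0" using parent[OF G'(1)] by blast
      have "G0 = G" using dis[of n] G0 G x G'(2) unfolding disjoint_def by blast
      then show "x \<in> (\<Union>G'\<in>Q. G' \<inter> \<Omega>)" using G' G0 x unfolding Q_def by blast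
    qed
    then have eq: "G \<inter> \<Omega> = (\<Union>G'\<in>Q. G' \<inter> \<Omega>)" unfolding Q_def by blast
    have QM: "G' \<inter> \<Omega> \<in> sets M" if "G' \<in> Q" for G' using PM[OF QP[OF that]] \<Omega>M by simp
    have disQ: "disjoint_family_on (\<lambda>G'. G' \<inter> \<Omega>) Q"
      using dis[of "Suc n"] QP unfolding disjoint_def disjoint_family_on_def by blast
    have mu: "measure M (G \<inter> \<Omega>) = (\<Sum>G'\<in>Q. measure M (G' \<inter> \<Omega>))"
      unfolding eq by (rule finite_measure_finite_Union[OF finQ _ disQ]) (use QM in auto)
    have "m (G \<inter> \<Omega>) = (\<Sum>G'\<in>Q. m (G' \<inter> \<Omega>))"
      unfolding eq by (rule m_UN_finite[OF finQ QM disQ])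
    also have "\<dots> = (\<Sum>G'\<in>Q. measure M (G' \<inter> \<Omega>) *\<^sub>R a G')"
      by (rule sum.cong) (use m_a QP in auto)
    finally have sum: "m (G \<inter> \<Omega>) = (\<Sum>G'\<in>Q. measure M (G' \<inter> \<Omega>) *\<^sub>R a G')" .
    have "a G = (1 / measure M (G \<inter> \<Omega>)) *\<^sub>R m (G \<inter> \<Omega>)" by (simp add: a_def avg_def)
    also have "\<dots> = (\<Sum>G'\<in>Q. (measure M (G' \<inter> \<Omega>) / measure M (G \<inter> \<Omega>)) *\<^sub>R a G')"
      unfolding sum by (simp add: scaleR_sum_right)
    also have "\<dots> \<in> convex hull (level (Suc n))"
    proof (rule convex_sum[OF finQ convex_convex_hull])
      show "(\<Sum>G'\<in>Q. measure M (G' \<inter> \<Omega>) / measure M (G \<inter> \<Omega>)) = 1"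
        using mu pos[OF G] by (simp flip: sum_divide_distrib)
      show "a G' \<in> convex hull (level (Suc n))" if "G' \<in> Q" for G'
        using QP[OF that] unfolding level_def by (intro hull_inc) simp
    qed simp
    finally show ?thesis .
  qed
  have body_neg: "- x \<in> body n" if "x \<in> body n" for x n
    using that unfolding body_def by (rule convex_hull_uminus_closed)
  have body_Suc: "body n \<subseteq> body (Suc n)" for n
  proof -
    have "convex hull (level (Suc n)) \<subseteq> body (Suc n)" unfolding body_def by (rule hull_mono) simp
    then have "level n \<subseteq> body (Suc n)" using children unfolding level_def by blast
    then have "level n \<union> uminus ` level n \<subseteq> body (Suc n)" using body_neg by blast
    then have "convex hull (level n \<union> uminus ` level n) \<subseteq> body (Suc n)"
      by (rule hull_minimal) (simp add: body_def convex_convex_hull)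
    then show ?thesis by (simp add: body_def)
  qed
  have body_le: "body i \<subseteq> body j" if "i \<le> j" for i j
    using lift_Suc_mono_le[of body, OF body_Suc that] .
  define K where "K = (\<Union>n. body n)"
  have K: "symmetric_convex K"
  proof
    show "convex K"
    proof (rule convexI)
      fix x y and u v :: real
      assume xy: "x \<in> K" "y \<in> K" and uv: "0 \<le> u" "0 \<le> v" "u + v = 1"
      obtain i j where "x \<in> body i" "y \<in> body j" using xy unfolding K_def by blast
      then have "x \<in> body (max i j)" "y \<in> body (max i j)"
        using body_le[of i "max i j"] body_le[of j "max i j"] by auto
      then have "u *\<^sub>R x + v *\<^sub>R y \<in> body (max i j)"
        using uv unfolding body_def by (intro convexD[OF convex_convex_hull])
      then show "u *\<^sub>R x + v *\<^sub>R y \<in> K" unfolding K_def by blast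
    qed
    have "a E \<in> body 0" unfolding body_def level_def P0 by (rule hull_inc) simp
    then show "K \<noteq> {}" unfolding K_def by blast
    show "- x \<in> K" if "x \<in> K" for x using that body_neg unfolding K_def by blast
  qed
  have bounded: "norm x \<le> L" if x: "x \<in> K" for x
  proof -
    have "body n \<subseteq> cball 0 L" for n
      unfolding body_def by (rule hull_minimal) (use a_norm in \<open>auto simp: level_def convex_cball\<close>)
    then show ?thesis using x unfolding K_def by fastforce
  qed
  have near: "\<exists>x'\<in>convex hull (avg ` P n \<union> uminus ` avg ` P n). norm (x - x') \<le> r / 4" if x: "x \<in> body n" for x n
  proof -
    let ?A = "convex hull (avg ` P n \<union> uminus ` avg ` P n)"
    let ?N = "\<Union>u\<in>?A. \<Union>v\<in>cball 0 (r / 4). {u + v}"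
    have "body n \<subseteq> ?N"
      unfolding body_def
    proof (rule hull_minimal)
      show "convex ?N" by (rule convex_sums[OF convex_convex_hull convex_cball])
      show "level n \<union> uminus ` level n \<subseteq> ?N"
      proof
        fix z assume "z \<in> level n \<union> uminus ` level n"
        then obtain G where G: "G \<in> P n" and z: "z = a G \<or> z = - a G" unfolding level_def by blast
        from z show "z \<in> ?N"
        proof
          assume z: "z = a G"
          have "avg G \<in> ?A" using G by (intro hull_inc) simp
          moreover have "z - avg G \<in> cball 0 (r / 4)" using a_avg[OF G] z by simp
          ultimately show ?thesis by (metis (no_types, lifting) UN_iff add_diff_cancel_left' add_diff_eq singletonI)
        next
          assume z: "z = - a G"
          have "- avg G \<in> ?A" using G by (intro hull_inc) simp
          moreover have "z - - avg G \<in> cball 0 (r / 4)" using a_avg[OF G] z by (simp add: norm_minus_commute)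
          ultimately show ?thesis by (metis (no_types, lifting) UN_iff add_diff_cancel_left' add_diff_eq singletonI)
        qed
      qed
    qed
    then obtain u v where "u \<in> ?A" "norm v \<le> r / 4" "x = u + v" using x by fastforce
    then show ?thesis by (intro bexI[of _ u]) auto
  qed
  have "\<exists>\<Psi> :: ('a \<Rightarrow>\<^sub>L real) set. finite \<Psi> \<and>
        (\<forall>(f :: 'a \<Rightarrow>\<^sub>L real). \<forall>x\<in>K. \<exists>v\<in>K. f x \<le> f v \<and> (\<exists>\<psi>\<in>\<Psi>. r / 2 \<le> \<bar>blinfun_apply \<psi> v - \<psi> k\<bar>))"
    if k: "k \<in> closure K" for k
  proof -
    obtain x where x: "x \<in> K" "norm (x - k) < r / 8"
      using k r unfolding closure_approachable dist_norm by (meson divide_pos_pos zero_less_numeral)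
    obtain n where n: "x \<in> body n" using x(1) unfolding K_def by blast
    obtain x' where x': "x' \<in> convex hull (avg ` P n \<union> uminus ` avg ` P n)" "norm (x - x') \<le> r / 4"
      using near[OF n] by blast
    have finA: "finite (avg ` P n)" using fin by simp
    \<comment> \<open>Vertices come with both signs: \<open>y1\<close> near \<open>k\<close> serves the vertices \<open>a G\<close>, and \<open>y2\<close> near \<open>- k\<close> serves
      the vertices \<open>- a G\<close>.\<close>
    obtain y1 where y1: "y1 \<in> net (avg ` P n)" "norm (x' - y1) < r / 8" using net(2)[OF finA x'(1)] by blast
    obtain y2 where y2: "y2 \<in> net (avg ` P n)" "norm (- x' - y2) < r / 8"
      using net(2)[OF finA convex_hull_uminus_closed[OF x'(1)]] by blast
    have k1: "norm (k - y1) < r / 2"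
    proof -
      have "k - y1 = (x - x') - (x - k) + (x' - y1)" by simp
      then have "norm (k - y1) \<le> norm (x - x') + norm (x - k) + norm (x' - y1)"
        using norm_triangle_ineq[of "(x - x') - (x - k)" "x' - y1"] norm_triangle_ineq4[of "x - x'" "x - k"] by simp
      then show ?thesis using x(2) x'(2) y1(2) by linarith
    qed
    have k2: "norm (- k - y2) < r / 2"
    proof -
      have "- k - y2 = (x - k) - (x - x') + (- x' - y2)" by simp
      then have "norm (- k - y2) \<le> norm (x - k) + norm (x - x') + norm (- x' - y2)"
        using norm_triangle_ineq[of "(x - k) - (x - x')" "- x' - y2"] norm_triangle_ineq4[of "x - k" "x - x'"] by simp
      then show ?thesis using x(2) x'(2) y2(2) by linarith
    qed
    have "\<exists>\<psi> :: 'a \<Rightarrow>\<^sub>L real. norm \<psi> \<le> 1 \<and> (\<forall>H\<in>sets M. H \<subseteq> G \<longrightarrow> (blinfun_apply \<psi> y + r) * measure M H \<le> \<psi> (m H))"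
      if "G \<in> P (Suc n)" "y \<in> net (avg ` P n)" for G y
      using esc[OF that] unfolding escapes_def .
    then obtain \<psi> :: "'b set \<Rightarrow> 'a \<Rightarrow> 'a \<Rightarrow>\<^sub>L real" where \<psi>:
      "\<And>G y. G \<in> P (Suc n) \<Longrightarrow> y \<in> net (avg ` P n) \<Longrightarrow> norm (\<psi> G y) \<le> 1"
      "\<And>G y H. G \<in> P (Suc n) \<Longrightarrow> y \<in> net (avg ` P n) \<Longrightarrow> H \<in> sets M \<Longrightarrow> H \<subseteq> G \<Longrightarrow>
         (\<psi> G y y + r) * measure M H \<le> \<psi> G y (m H)"
      by metis
    define \<Psi> where "\<Psi> = (\<lambda>G. \<psi> G y1) ` P (Suc n) \<union> (\<lambda>G. \<psi> G y2) ` P (Suc n)"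
    have "\<exists>v\<in>K. f x \<le> f v \<and> (\<exists>\<psi>\<in>\<Psi>. r / 2 \<le> \<bar>blinfun_apply \<psi> v - \<psi> k\<bar>)" if xK: "x \<in> K" for f :: "'a \<Rightarrow>\<^sub>L real" and x
    proof -
      obtain i where "x \<in> body i" using xK unfolding K_def by blast
      then have xh: "x \<in> body (Suc n + i)" using body_le[of i "Suc n + i"] by auto
      have "\<exists>v\<in>level (Suc n + i) \<union> uminus ` level (Suc n + i). f x \<le> f v"
      proof (rule ccontr)
        assume "\<not> ?thesis"
        then have "level (Suc n + i) \<union> uminus ` level (Suc n + i) \<subseteq> {z. f z < f x}" by (auto simp: not_le)
        moreover have "convex {z. f z < f x}"
          by (rule convexI) (simp add: blinfun.add_right blinfun.scaleR_right convex_bound_lt)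
        ultimately have "body (Suc n + i) \<subseteq> {z. f z < f x}" unfolding body_def by (rule hull_minimal)
        with xh show False by blast
      qed
      then obtain v where v: "v \<in> level (Suc n + i) \<union> uminus ` level (Suc n + i)" "f x \<le> f v" by blast
      have "v \<in> body (Suc n + i)" unfolding body_def by (rule hull_inc[OF v(1)])
      then have vK: "v \<in> K" unfolding K_def by blast
      obtain G where G: "G \<in> P (Suc n + i)" and vG: "v = a G \<or> v = - a G" using v(1) unfolding level_def by blast
      obtain G' where G': "G' \<in> P (Suc n)" "G \<subseteq> G'" using ancestor[OF G] by blast
      have sep: "\<psi> G' y y + r \<le> \<psi> G' y (a G)" if y: "y \<in> net (avg ` P n)" for y
      proof -
        have "(\<psi> G' y y + r) * measure M (G \<inter> \<Omega>) \<le> \<psi> G' y (m (G \<inter> \<Omega>))"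
          by (rule \<psi>(2)[OF G'(1) y]) (use PM[OF G] \<Omega>M G'(2) in auto)
        then show ?thesis using pos[OF G] unfolding m_a[OF G] by (simp add: blinfun.scaleR_right mult.commute)
      qed
      have contr: "\<bar>\<psi> G' y z\<bar> \<le> norm z" if y: "y \<in> net (avg ` P n)" for y z
        using norm_blinfun[of "\<psi> G' y" z] mult_right_mono[OF \<psi>(1)[OF G'(1) y], of "norm z"] by simp
      from vG have "\<exists>\<xi>\<in>\<Psi>. r / 2 \<le> \<bar>blinfun_apply \<xi> v - \<xi> k\<bar>"
      proof
        assume "v = a G"
        then have "r / 2 \<le> \<bar>\<psi> G' y1 v - \<psi> G' y1 k\<bar>"
          using sep[OF y1(1)] contr[OF y1(1), of "k - y1"] k1 by (simp add: blinfun.diff_right)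
        then show ?thesis using G'(1) unfolding \<Psi>_def by blast
      next
        assume "v = - a G"
        then have "r / 2 \<le> \<bar>\<psi> G' y2 v - \<psi> G' y2 k\<bar>"
          using sep[OF y2(1)] contr[OF y2(1), of "- k - y2"] k2
          by (simp add: blinfun.diff_right blinfun.minus_right)
        then show ?thesis using G'(1) unfolding \<Psi>_def by blast
      qed
      then show ?thesis using v(2) vK by blast
    qed
    moreover have "finite \<Psi>" unfolding \<Psi>_def using fin by simp
    ultimately show ?thesis by blast
  qed
  then show ?thesis using K bounded by blast
qed

end

section \<open>Very smooth points and the Radon-Nikodym property\<close>

lemma common_slice:
  fixes f :: "'v::real_normed_vector \<Rightarrow>\<^sub>L real"
  assumes "finite \<Psi>" and "\<And>\<psi> :: 'v \<Rightarrow>\<^sub>L real. \<exists>\<delta>>0. \<forall>a\<in>K. \<sigma> - \<delta> < f a \<longrightarrow> \<bar>\<psi> a - \<psi> k\<bar> < e"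
  shows "\<exists>\<delta>>0. \<forall>\<psi>\<in>\<Psi>. \<forall>a\<in>K. \<sigma> - \<delta> < f a \<longrightarrow> \<bar>blinfun_apply \<psi> a - \<psi> k\<bar> < e"
  using assms(1)
proof (induction \<Psi> rule: finite_induct)
  case empty
  then show ?case by (intro exI[of _ 1]) simp
next
  case (insert \<psi> \<Psi>)
  then obtain \<delta>1 where 1: "0 < \<delta>1" "\<And>\<psi> a. \<psi> \<in> \<Psi> \<Longrightarrow> a \<in> K \<Longrightarrow> \<sigma> - \<delta>1 < f a \<Longrightarrow> \<bar>\<psi> a - \<psi> k\<bar> < e" by blast
  obtain \<delta>2 where 2: "0 < \<delta>2" "\<And>a. a \<in> K \<Longrightarrow> \<sigma> - \<delta>2 < f a \<Longrightarrow> \<bar>\<psi> a - \<psi> k\<bar> < e" using assms(2) by blast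
  have "\<bar>\<phi> a - \<phi> k\<bar> < e" if "\<phi> \<in> insert \<psi> \<Psi>" "a \<in> K" "\<sigma> - min \<delta>1 \<delta>2 < f a" for \<phi> a
    using 1(2)[of \<phi> a] 2(2)[of a] that by auto
  then show ?case using 1(1) 2(1) by (intro exI[of _ "min \<delta>1 \<delta>2"]) auto
qed

theorem proposition19:
  assumes "\<And>p :: 'a::banach \<Rightarrow> real. equivalent_norm p \<Longrightarrow>
             \<exists>f :: 'a \<Rightarrow>\<^sub>L real. very_smooth_point (dual_norm p) f"
  shows "radon_nikodym_property TYPE('a) TYPE('b)"
  unfolding radon_nikodym_property_def
proof (intro allI impI)
  fix M :: "'b measure" and m :: "'b set \<Rightarrow> 'a"
  assume M: "finite_measure M" "vector_measure M m" "bounded_variation M m" "vm_absolutely_continuous M m"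
  interpret finite_measure M by (rule M(1))
  interpret continuous_vector_measure M m by unfold_locales (rule M)+
  show "\<exists>g. \<forall>E\<in>sets M. has_strong_bochner_integral M (\<lambda>w. indicator E w *\<^sub>R g w) (m E)"
  proof (rule density_if_approximable, rule ccontr)
    fix e :: real assume "0 < e" "\<nexists>t. approximates e t"
    then obtain r F where r: "0 < r" and F: "F \<in> sets M" "0 < measure M F"
      "\<And>H. H \<in> sets M \<Longrightarrow> H \<subseteq> F \<Longrightarrow> 0 < measure M H \<Longrightarrow> \<not> nearly_constant r H"
      using approximates_if_nearly_constant_pieces by meson
    obtain E L where E: "E \<in> sets M" "E \<subseteq> F" "0 < measure M E"
      "\<And>H. H \<in> sets M \<Longrightarrow> H \<subseteq> E \<Longrightarrow> norm (m H) \<le> L * measure M H"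
      using lipschitz_piece[OF F(1,2)] by blast
    interpret nowhere_nearly_constant M m E r L
      by unfold_locales (use E r F(3) in auto)
    obtain K :: "'a set" and B where K: "symmetric_convex K" "\<And>a. a \<in> K \<Longrightarrow> norm a \<le> B"
      and escape: "\<And>k. k \<in> closure K \<Longrightarrow> \<exists>\<Psi> :: ('a \<Rightarrow>\<^sub>L real) set. finite \<Psi> \<and>
        (\<forall>(f :: 'a \<Rightarrow>\<^sub>L real). \<forall>a\<in>K. \<exists>v\<in>K. f a \<le> f v \<and> (\<exists>\<psi>\<in>\<Psi>. r / 2 \<le> \<bar>blinfun_apply \<psi> v - \<psi> k\<bar>))"
      using exists_set_with_escaping_slices by blast
    obtain f :: "'a \<Rightarrow>\<^sub>L real" and \<sigma> k where k: "k \<in> closure K"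
      and sup: "\<And>\<delta>. 0 < \<delta> \<Longrightarrow> \<exists>a\<in>K. \<sigma> - \<delta> < f a"
      and slices: "\<And>(\<psi> :: 'a \<Rightarrow>\<^sub>L real) e. 0 < e \<Longrightarrow> \<exists>\<delta>>0. \<forall>a\<in>K. \<sigma> - \<delta> < f a \<longrightarrow> \<bar>\<psi> a - \<psi> k\<bar> < e"
      using exists_weakly_strongly_exposed_point[OF assms K] by blast
    obtain \<Psi> :: "('a \<Rightarrow>\<^sub>L real) set" where \<Psi>: "finite \<Psi>"
      "\<And>(f :: 'a \<Rightarrow>\<^sub>L real) a. a \<in> K \<Longrightarrow> \<exists>v\<in>K. f a \<le> f v \<and> (\<exists>\<psi>\<in>\<Psi>. r / 2 \<le> \<bar>blinfun_apply \<psi> v - \<psi> k\<bar>)"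
      using escape[OF k] by blast
    have "0 < r / 2" using r by simp
    from common_slice[OF \<Psi>(1) slices[OF this]] obtain \<delta> where \<delta>: "0 < \<delta>"
      "\<And>\<psi> a. \<psi> \<in> \<Psi> \<Longrightarrow> a \<in> K \<Longrightarrow> \<sigma> - \<delta> < f a \<Longrightarrow> \<bar>\<psi> a - \<psi> k\<bar> < r / 2" by blast
    obtain a where a: "a \<in> K" "\<sigma> - \<delta> < f a" using sup[OF \<delta>(1)] by blast
    obtain v \<psi> where v: "v \<in> K" "f a \<le> f v" "\<psi> \<in> \<Psi>" "r / 2 \<le> \<bar>blinfun_apply \<psi> v - \<psi> k\<bar>" using \<Psi>(2)[OF a(1), of f] by blast
    then show False using \<delta>(2)[OF v(3,1)] a(2) by simp
  qed
qed

end
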